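(* Let $K$ be a field of characteristic zero and let $c\ge 3$ be an integer. Let $F_{3,c}$ be the free-nilpotent Lie algebra over $K$ with $3$ generators and nilpotency class $c$. Then every CPA-structure on $F_{3,c}$ is central.
   Context: A commutative post-Lie algebra structure, or CPA-structure, on a Lie algebra $\mathfrak{g}$ over $K$ is a $K$-bilinear product $x\cdot y$ on the vector space $\mathfrak{g}$ such that for all $x,y,z\in\mathfrak{g}$: (1) $x\cdot y=y\cdot x$; (2) $[x,y]\cdot z=x\cdot(y\cdot z)-y\cdot(x\cdot z)$; (3) $x\cdot[y,z]=[x\cdot y,z]+[y,x\cdot z]$. A CPA-structure on a nilpotent Lie algebra $\mathfrak{g}$ is called central if $\mathfrak{g}\cdot\mathfrak{g}\subseteq Z(\mathfrak{g})$, where $Z(\mathfrak{g})$ is the center of $\mathfrak{g}$. The lower central series of a Lie algebra is $\mathfrak{g}^1=\mathfrak{g}$, $\mathfrak{g}^{i+1}=[\mathfrak{g},\mathfrak{g}^i]$. If $F_g$ is the free Lie algebra over $K$ on $g$ generators, the free-nilpotent Lie algebra with $g$ generators and nilpotency class $c$ is $F_{g,c}=F_g/F_g^{c+1}$. *)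

theory Defs
  imports "HOL-Algebra.Algebraic_Closure_Type" "HOL-Library.Cardinality"
begin

section \<open>Lie algebras with explicit carriers\<close>

text \<open>
  A Lie algebra is a record of the library type \<^typ>\<open>('k, 'a) module\<close> whose multiplication is
  the bracket: \<open>x \<otimes>\<^bsub>L\<^esub> y\<close> is $[x,y]$. The record field \<open>one\<close> is never used and has no meaning.
\<close>

locale lie_algebra = K?: field K + L?: module K L
  for K :: "'k ring" (structure) and L :: "('k, 'a) module" (structure) +
  assumes bracket_closed [simp, intro]:
      "\<lbrakk>x \<in> carrier L; y \<in> carrier L\<rbrakk> \<Longrightarrow> x \<otimes>\<^bsub>L\<^esub> y \<in> carrier L"
    and bracket_add_left:
      "\<lbrakk>x \<in> carrier L; y \<in> carrier L; z \<in> carrier L\<rbrakk> \<Longrightarrow>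
       (x \<oplus>\<^bsub>L\<^esub> y) \<otimes>\<^bsub>L\<^esub> z = (x \<otimes>\<^bsub>L\<^esub> z) \<oplus>\<^bsub>L\<^esub> (y \<otimes>\<^bsub>L\<^esub> z)"
    and bracket_add_right:
      "\<lbrakk>x \<in> carrier L; y \<in> carrier L; z \<in> carrier L\<rbrakk> \<Longrightarrow>
       x \<otimes>\<^bsub>L\<^esub> (y \<oplus>\<^bsub>L\<^esub> z) = (x \<otimes>\<^bsub>L\<^esub> y) \<oplus>\<^bsub>L\<^esub> (x \<otimes>\<^bsub>L\<^esub> z)"
    and bracket_smult_left:
      "\<lbrakk>a \<in> carrier K; x \<in> carrier L; y \<in> carrier L\<rbrakk> \<Longrightarrow>
       (a \<odot>\<^bsub>L\<^esub> x) \<otimes>\<^bsub>L\<^esub> y = a \<odot>\<^bsub>L\<^esub> (x \<otimes>\<^bsub>L\<^esub> y)"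
    and bracket_smult_right:
      "\<lbrakk>a \<in> carrier K; x \<in> carrier L; y \<in> carrier L\<rbrakk> \<Longrightarrow>
       x \<otimes>\<^bsub>L\<^esub> (a \<odot>\<^bsub>L\<^esub> y) = a \<odot>\<^bsub>L\<^esub> (x \<otimes>\<^bsub>L\<^esub> y)"
    and bracket_self: "x \<in> carrier L \<Longrightarrow> x \<otimes>\<^bsub>L\<^esub> x = \<zero>\<^bsub>L\<^esub>"
    and jacobi:
      "\<lbrakk>x \<in> carrier L; y \<in> carrier L; z \<in> carrier L\<rbrakk> \<Longrightarrow>
       x \<otimes>\<^bsub>L\<^esub> (y \<otimes>\<^bsub>L\<^esub> z) \<oplus>\<^bsub>L\<^esub> y \<otimes>\<^bsub>L\<^esub> (z \<otimes>\<^bsub>L\<^esub> x) \<oplus>\<^bsub>L\<^esub> z \<otimes>\<^bsub>L\<^esub> (x \<otimes>\<^bsub>L\<^esub> y) = \<zero>\<^bsub>L\<^esub>"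

definition lie_center :: "('k, 'a) module \<Rightarrow> 'a set"
  where "lie_center L = {z \<in> carrier L. \<forall>x \<in> carrier L. x \<otimes>\<^bsub>L\<^esub> z = \<zero>\<^bsub>L\<^esub>}"

text \<open>$[A,B]$ is the linear span of the brackets, not merely the set of brackets.\<close>

definition bracket_span :: "'k ring \<Rightarrow> ('k, 'a) module \<Rightarrow> 'a set \<Rightarrow> 'a set \<Rightarrow> 'a set"
  where "bracket_span K L A B =
    (\<lambda>N. submodule N K L) hull {x \<otimes>\<^bsub>L\<^esub> y | x y. x \<in> A \<and> y \<in> B}"

text \<open>Indexed so that \<open>lower_central K L i\<close> is $L^i$ with $L^1 = L$; the value at 0 is a dummy.\<close>

fun lower_central :: "'k ring \<Rightarrow> ('k, 'a) module \<Rightarrow> nat \<Rightarrow> 'a set" where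
  "lower_central K L 0 = carrier L"
| "lower_central K L (Suc 0) = carrier L"
| "lower_central K L (Suc (Suc i)) = bracket_span K L (carrier L) (lower_central K L (Suc i))"

text \<open>
  The additive structure and the bracket are those of the library's quotient by cosets
  (\<^const>\<open>FactRing\<close>, whose definition does not need associativity or a unit).
\<close>

definition lie_quotient :: "('k, 'a) module \<Rightarrow> 'a set \<Rightarrow> ('k, 'a set) module"
  where "lie_quotient L I =
    \<lparr>carrier = carrier (L Quot I), monoid.mult = monoid.mult (L Quot I), one = one (L Quot I),
     zero = zero (L Quot I), add = add (L Quot I),
     module.smult = (\<lambda>a A. \<Union>x\<in>A. I +>\<^bsub>L\<^esub> (a \<odot>\<^bsub>L\<^esub> x))\<rparr>"


section \<open>CPA-structures\<close>

locale cpa_structure = lie_algebra +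
  fixes dot :: "'b \<Rightarrow> 'b \<Rightarrow> 'b"  (infixl \<open>\<cdot>\<close> 75)
  assumes dot_closed:
      "\<lbrakk>x \<in> carrier L; y \<in> carrier L\<rbrakk> \<Longrightarrow> x \<cdot> y \<in> carrier L"
    and dot_add_left:
      "\<lbrakk>x \<in> carrier L; y \<in> carrier L; z \<in> carrier L\<rbrakk> \<Longrightarrow>
       (x \<oplus>\<^bsub>L\<^esub> y) \<cdot> z = (x \<cdot> z) \<oplus>\<^bsub>L\<^esub> (y \<cdot> z)"
    and dot_add_right:
      "\<lbrakk>x \<in> carrier L; y \<in> carrier L; z \<in> carrier L\<rbrakk> \<Longrightarrow>
       x \<cdot> (y \<oplus>\<^bsub>L\<^esub> z) = (x \<cdot> y) \<oplus>\<^bsub>L\<^esub> (x \<cdot> z)"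
    and dot_smult_left:
      "\<lbrakk>a \<in> carrier K; x \<in> carrier L; y \<in> carrier L\<rbrakk> \<Longrightarrow>
       (a \<odot>\<^bsub>L\<^esub> x) \<cdot> y = a \<odot>\<^bsub>L\<^esub> (x \<cdot> y)"
    and dot_smult_right:
      "\<lbrakk>a \<in> carrier K; x \<in> carrier L; y \<in> carrier L\<rbrakk> \<Longrightarrow>
       x \<cdot> (a \<odot>\<^bsub>L\<^esub> y) = a \<odot>\<^bsub>L\<^esub> (x \<cdot> y)"
    and dot_commute:
      "\<lbrakk>x \<in> carrier L; y \<in> carrier L\<rbrakk> \<Longrightarrow> x \<cdot> y = y \<cdot> x"
    and bracket_dot:
      "\<lbrakk>x \<in> carrier L; y \<in> carrier L; z \<in> carrier L\<rbrakk> \<Longrightarrow>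
       (x \<otimes>\<^bsub>L\<^esub> y) \<cdot> z = (x \<cdot> (y \<cdot> z)) \<ominus>\<^bsub>L\<^esub> (y \<cdot> (x \<cdot> z))"
    and dot_bracket:
      "\<lbrakk>x \<in> carrier L; y \<in> carrier L; z \<in> carrier L\<rbrakk> \<Longrightarrow>
       x \<cdot> (y \<otimes>\<^bsub>L\<^esub> z) = ((x \<cdot> y) \<otimes>\<^bsub>L\<^esub> z) \<oplus>\<^bsub>L\<^esub> (y \<otimes>\<^bsub>L\<^esub> (x \<cdot> z))"

definition central_product :: "('k, 'a) module \<Rightarrow> ('a \<Rightarrow> 'a \<Rightarrow> 'a) \<Rightarrow> bool"
  where "central_product L dot \<longleftrightarrow>
    (\<forall>x \<in> carrier L. \<forall>y \<in> carrier L. dot x y \<in> lie_center L)"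


section \<open>The free Lie algebra\<close>

text \<open>
  The free Lie algebra over \<open>'k\<close> on the set of all elements of \<open>'x\<close>: terms in the operations of a
  Lie algebra modulo the least congruence that contains the Lie algebra axioms.
  Theorem \<open>free_lie_universal\<close> below is its universal property.
\<close>

datatype ('k, 'x) lie_term =
    TGen 'x
  | TZero
  | TAdd "('k, 'x) lie_term" "('k, 'x) lie_term"
  | TNeg "('k, 'x) lie_term"
  | TSmult 'k "('k, 'x) lie_term"
  | TBracket "('k, 'x) lie_term" "('k, 'x) lie_term"

inductive lie_eq :: "('k::field, 'x) lie_term \<Rightarrow> ('k, 'x) lie_term \<Rightarrow> bool" where
  refl: "lie_eq s s"
| sym: "lie_eq s t \<Longrightarrow> lie_eq t s"
| trans: "lie_eq s t \<Longrightarrow> lie_eq t u \<Longrightarrow> lie_eq s u"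
| cong_add: "lie_eq s s' \<Longrightarrow> lie_eq t t' \<Longrightarrow> lie_eq (TAdd s t) (TAdd s' t')"
| cong_neg: "lie_eq s s' \<Longrightarrow> lie_eq (TNeg s) (TNeg s')"
| cong_smult: "lie_eq s s' \<Longrightarrow> lie_eq (TSmult a s) (TSmult a s')"
| cong_bracket: "lie_eq s s' \<Longrightarrow> lie_eq t t' \<Longrightarrow> lie_eq (TBracket s t) (TBracket s' t')"
| add_assoc: "lie_eq (TAdd (TAdd s t) u) (TAdd s (TAdd t u))"
| add_commute: "lie_eq (TAdd s t) (TAdd t s)"
| add_zero: "lie_eq (TAdd TZero s) s"
| add_neg: "lie_eq (TAdd (TNeg s) s) TZero"
| smult_add_left: "lie_eq (TSmult (a + b) s) (TAdd (TSmult a s) (TSmult b s))"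
| smult_add_right: "lie_eq (TSmult a (TAdd s t)) (TAdd (TSmult a s) (TSmult a t))"
| smult_smult: "lie_eq (TSmult (a * b) s) (TSmult a (TSmult b s))"
| smult_1: "lie_eq (TSmult 1 s) s"
| br_add_left: "lie_eq (TBracket (TAdd s t) u) (TAdd (TBracket s u) (TBracket t u))"
| br_add_right: "lie_eq (TBracket s (TAdd t u)) (TAdd (TBracket s t) (TBracket s u))"
| br_smult_left: "lie_eq (TBracket (TSmult a s) t) (TSmult a (TBracket s t))"
| br_smult_right: "lie_eq (TBracket s (TSmult a t)) (TSmult a (TBracket s t))"
| br_self: "lie_eq (TBracket s s) TZero"
| br_jacobi: "lie_eq (TAdd (TAdd (TBracket s (TBracket t u)) (TBracket t (TBracket u s)))
                      (TBracket u (TBracket s t))) TZero"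

quotient_type (overloaded) ('k, 'x) free_lie = "('k::field, 'x) lie_term" / lie_eq
  by (intro equivpI reflpI sympI transpI) (blast intro: lie_eq.refl lie_eq.sym lie_eq.trans)+

instantiation free_lie :: (field, type) ab_group_add
begin

lift_definition zero_free_lie :: "('a, 'b) free_lie" is TZero .
lift_definition plus_free_lie :: "('a, 'b) free_lie \<Rightarrow> ('a, 'b) free_lie \<Rightarrow> ('a, 'b) free_lie"
  is TAdd by (rule lie_eq.cong_add)
lift_definition uminus_free_lie :: "('a, 'b) free_lie \<Rightarrow> ('a, 'b) free_lie"
  is TNeg by (rule lie_eq.cong_neg)
definition minus_free_lie :: "('a, 'b) free_lie \<Rightarrow> ('a, 'b) free_lie \<Rightarrow> ('a, 'b) free_lie"
  where "minus_free_lie x y = x + - y"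

instance
  by standard
    (transfer, blast intro: lie_eq.intros, (simp add: minus_free_lie_def)?)+

end

lift_definition lie_gen :: "'x \<Rightarrow> ('k::field, 'x) free_lie" is TGen .
lift_definition lie_smult :: "'k::field \<Rightarrow> ('k, 'x) free_lie \<Rightarrow> ('k, 'x) free_lie"
  is TSmult by (rule lie_eq.cong_smult)
lift_definition lie_bracket ::
    "('k::field, 'x) free_lie \<Rightarrow> ('k, 'x) free_lie \<Rightarrow> ('k, 'x) free_lie"
  is TBracket by (rule lie_eq.cong_bracket)

definition free_lie_algebra :: "('k::field, ('k, 'x) free_lie) module"
  where "free_lie_algebra =
    \<lparr>carrier = UNIV, monoid.mult = lie_bracket, one = undefined, zero = 0, add = (+),
     module.smult = lie_smult\<rparr>"

abbreviation scalars :: "'k::field ring"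
  where "scalars \<equiv> ring_of_type_algebra"

lemma scalars_simps [simp]:
  "carrier (scalars :: 'k::field ring) = UNIV"
  "a \<oplus>\<^bsub>scalars\<^esub> b = a + (b :: 'k)"
  "a \<otimes>\<^bsub>scalars\<^esub> b = a * (b :: 'k)"
  "\<zero>\<^bsub>scalars\<^esub> = (0 :: 'k)"
  "\<one>\<^bsub>scalars\<^esub> = (1 :: 'k)"
  by (simp_all add: ring_of_type_algebra_def)

lemma free_lie_algebra_simps [simp]:
  "carrier free_lie_algebra = UNIV"
  "x \<oplus>\<^bsub>free_lie_algebra\<^esub> y = x + y"
  "x \<otimes>\<^bsub>free_lie_algebra\<^esub> y = lie_bracket x y"
  "\<zero>\<^bsub>free_lie_algebra\<^esub> = 0"
  "a \<odot>\<^bsub>free_lie_algebra\<^esub> x = lie_smult a x"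
  by (simp_all add: free_lie_algebra_def)

lemma lie_algebra_free:
  "lie_algebra scalars (free_lie_algebra :: ('k::field, ('k, 'x) free_lie) module)"
proof -
  have sc: "Ring.field (scalars :: 'k ring)"
    by (rule field_from_type_algebra)
  have ab: "abelian_group (free_lie_algebra :: ('k, ('k, 'x) free_lie) module)"
    by (rule abelian_groupI) (auto simp: add_ac intro: exI[of _ "- x" for x] left_minus)
  show ?thesis
    apply (intro lie_algebra.intro lie_algebra_axioms.intro moduleI sc ab)
                   apply simp_all
           apply (transfer, blast intro: lie_eq.intros)+
    done
qed

definition lie_hom :: "'k ring \<Rightarrow> ('k, 'a) module \<Rightarrow> ('k, 'b) module \<Rightarrow> ('a \<Rightarrow> 'b) \<Rightarrow> bool"
  where "lie_hom K L M h \<longleftrightarrow>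
    h \<in> carrier L \<rightarrow> carrier M \<and>
    (\<forall>x \<in> carrier L. \<forall>y \<in> carrier L. h (x \<oplus>\<^bsub>L\<^esub> y) = h x \<oplus>\<^bsub>M\<^esub> h y) \<and>
    (\<forall>a \<in> carrier K. \<forall>x \<in> carrier L. h (a \<odot>\<^bsub>L\<^esub> x) = a \<odot>\<^bsub>M\<^esub> h x) \<and>
    (\<forall>x \<in> carrier L. \<forall>y \<in> carrier L. h (x \<otimes>\<^bsub>L\<^esub> y) = h x \<otimes>\<^bsub>M\<^esub> h y)"

primrec lie_term_eval :: "('k, 'a) module \<Rightarrow> ('x \<Rightarrow> 'a) \<Rightarrow> ('k, 'x) lie_term \<Rightarrow> 'a" where
  "lie_term_eval L f (TGen x) = f x"
| "lie_term_eval L f TZero = \<zero>\<^bsub>L\<^esub>"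
| "lie_term_eval L f (TAdd s t) = lie_term_eval L f s \<oplus>\<^bsub>L\<^esub> lie_term_eval L f t"
| "lie_term_eval L f (TNeg s) = \<ominus>\<^bsub>L\<^esub> lie_term_eval L f s"
| "lie_term_eval L f (TSmult a s) = a \<odot>\<^bsub>L\<^esub> lie_term_eval L f s"
| "lie_term_eval L f (TBracket s t) = lie_term_eval L f s \<otimes>\<^bsub>L\<^esub> lie_term_eval L f t"

theorem free_lie_universal:
  fixes L :: "('k::field, 'a) module" and f :: "'x \<Rightarrow> 'a"
  assumes L: "lie_algebra scalars L" and f: "\<And>x. f x \<in> carrier L"
  shows "\<exists>!h. lie_hom scalars free_lie_algebra L h \<and> (\<forall>x. h (lie_gen x) = f x)"
proof -
  interpret L: lie_algebra scalars L by (rule L)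
  have cl: "lie_term_eval L f t \<in> carrier L" for t
    by (induction t) (auto simp: f)
  have resp: "lie_term_eval L f s = lie_term_eval L f t" if "lie_eq s t" for s t
    using that
  proof induction
    case (smult_add_left a b s)
    then show ?case using L.smult_l_distr[of a b] by (simp add: cl)
  next
    case (smult_add_right a s t)
    then show ?case using L.smult_r_distr by (simp add: cl)
  next
    case (smult_smult a b s)
    then show ?case using L.smult_assoc1[of a b] by (simp add: cl)
  next
    case (smult_1 s)
    then show ?case using L.smult_one by (simp add: cl)
  next
    case (add_assoc s t u)
    then show ?case by (simp add: cl L.M.add.m_assoc)
  next
    case (add_commute s t)
    then show ?case by (simp add: cl L.M.add.m_comm)
  next
    case (add_neg s)
    then show ?case by (simp add: cl L.M.l_neg)
  qed (simp_all add: cl L.bracket_add_left L.bracket_add_right L.bracket_smult_left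
      L.bracket_smult_right L.bracket_self L.jacobi)
  define h where "h x = lie_term_eval L f (rep_free_lie x)" for x :: "('k, 'x) free_lie"
  have h_abs: "h (abs_free_lie t) = lie_term_eval L f t" for t
    unfolding h_def
    by (rule resp) (meson Quotient3_free_lie lie_eq.refl rep_abs_rsp_left)
  show ?thesis
  proof (rule ex1I[of _ h])
    have "h (x + y) = h x \<oplus>\<^bsub>L\<^esub> h y" for x y
      by (induction x, induction y) (simp add: plus_free_lie.abs_eq h_abs)
    moreover have "h (lie_smult a x) = a \<odot>\<^bsub>L\<^esub> h x" for a x
      by (induction x) (simp add: lie_smult.abs_eq h_abs)
    moreover have "h (lie_bracket x y) = h x \<otimes>\<^bsub>L\<^esub> h y" for x y
      by (induction x, induction y) (simp add: lie_bracket.abs_eq h_abs)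
    moreover have "h (lie_gen x) = f x" for x
      by (simp add: lie_gen.abs_eq h_abs)
    moreover have "h x \<in> carrier L" for x
      by (simp add: h_def cl)
    ultimately show "lie_hom scalars free_lie_algebra L h \<and> (\<forall>x. h (lie_gen x) = f x)"
      by (simp add: lie_hom_def)
  next
    fix g assume g: "lie_hom scalars free_lie_algebra L g \<and> (\<forall>x. g (lie_gen x) = f x)"
    then have g1: "\<And>x y. g (x + y) = g x \<oplus>\<^bsub>L\<^esub> g y" "\<And>a x. g (lie_smult a x) = a \<odot>\<^bsub>L\<^esub> g x"
      "\<And>x y. g (lie_bracket x y) = g x \<otimes>\<^bsub>L\<^esub> g y" "\<And>x. g (lie_gen x) = f x"
      "\<And>x. g x \<in> carrier L"
      by (auto simp: lie_hom_def)
    have g0: "g 0 = \<zero>\<^bsub>L\<^esub>"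
      using g1(1)[of 0 0] g1(5)[of 0] by (metis L.M.add.r_cancel_one' add.right_neutral)
    have gm: "g (- x) = \<ominus>\<^bsub>L\<^esub> g x" for x
      using g1(1)[of "- x" x] g1(5) g0 by (metis L.M.minus_equality left_minus)
    have "g (abs_free_lie t) = lie_term_eval L f t" for t
    proof (induction t)
      case (TGen x)
      then show ?case using g1(4)[of x] by (simp add: lie_gen.abs_eq)
    next
      case TZero
      then show ?case using g0 by (simp add: zero_free_lie.abs_eq)
    next
      case (TAdd s t)
      then show ?case using g1(1)[of "abs_free_lie s" "abs_free_lie t"]
        by (simp add: plus_free_lie.abs_eq)
    next
      case (TNeg s)
      then show ?case using gm[of "abs_free_lie s"] by (simp add: uminus_free_lie.abs_eq)
    next
      case (TSmult a s)
      then show ?case using g1(2)[of a "abs_free_lie s"] by (simp add: lie_smult.abs_eq)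
    next
      case (TBracket s t)
      then show ?case using g1(3)[of "abs_free_lie s" "abs_free_lie t"]
        by (simp add: lie_bracket.abs_eq)
    qed
    then show "g = h"
      by (metis (no_types, opaque_lifting) Quotient3_abs_rep Quotient3_free_lie ext h_def)
  qed
qed


section \<open>Free-nilpotent Lie algebras\<close>

text \<open>
  The free-nilpotent Lie algebra $F/F^{c+1}$ of class \<open>c\<close>, where $F$ is the free Lie algebra on \<open>'x\<close>;
  the number of generators is \<open>CARD('x)\<close>.
\<close>

definition free_nilpotent :: "nat \<Rightarrow> ('k::field, ('k, 'x) free_lie set) module"
  where "free_nilpotent c =
    lie_quotient free_lie_algebra (lower_central scalars free_lie_algebra (Suc c))"


text \<open>The quotient is a Lie algebra, so the premise of \<^locale>\<open>cpa_structure\<close> holds for it.\<close>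

lemma (in lie_algebra) lie_algebra_quotient:
  assumes I: "submodule I K L"
    and br: "\<And>x i. x \<in> carrier L \<Longrightarrow> i \<in> I \<Longrightarrow> x \<otimes>\<^bsub>L\<^esub> i \<in> I"
  shows "lie_algebra K (lie_quotient L I)"
proof -
  interpret I: submodule I K L by (rule I)
  interpret A: abelian_subgroup I L
    by (rule abelian_subgroupI3) (auto intro: additive_subgroup.intro I.subgroup_axioms
        L.M.abelian_group_axioms)
  have Isub: "i \<in> I \<Longrightarrow> i \<in> carrier L" for i
    using A.a_subset by blast
  have anti: "x \<otimes>\<^bsub>L\<^esub> y = \<ominus>\<^bsub>L\<^esub> (y \<otimes>\<^bsub>L\<^esub> x)" if "x \<in> carrier L" "y \<in> carrier L" for x y
  proof -
    have "\<zero>\<^bsub>L\<^esub> = (x \<oplus>\<^bsub>L\<^esub> y) \<otimes>\<^bsub>L\<^esub> (x \<oplus>\<^bsub>L\<^esub> y)"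
      using that by (intro bracket_self[symmetric]) simp
    also have "\<dots> = (x \<oplus>\<^bsub>L\<^esub> y) \<otimes>\<^bsub>L\<^esub> x \<oplus>\<^bsub>L\<^esub> (x \<oplus>\<^bsub>L\<^esub> y) \<otimes>\<^bsub>L\<^esub> y"
      using that by (intro bracket_add_right) auto
    also have "\<dots> = y \<otimes>\<^bsub>L\<^esub> x \<oplus>\<^bsub>L\<^esub> x \<otimes>\<^bsub>L\<^esub> y"
      using that by (simp add: bracket_add_left bracket_self)
    finally have "x \<otimes>\<^bsub>L\<^esub> y \<oplus>\<^bsub>L\<^esub> y \<otimes>\<^bsub>L\<^esub> x = \<zero>\<^bsub>L\<^esub>"
      using that by (simp add: L.M.add.m_comm)
    then show ?thesis
      using that by (metis bracket_closed L.M.minus_equality)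
  qed
  have br': "i \<otimes>\<^bsub>L\<^esub> x \<in> I" if "x \<in> carrier L" "i \<in> I" for x i
    using that by (metis A.a_inv_closed Isub anti br)
  have coset: "I +>\<^bsub>L\<^esub> x = I +>\<^bsub>L\<^esub> y \<longleftrightarrow> (\<exists>i\<in>I. y = i \<oplus>\<^bsub>L\<^esub> x)"
    if "x \<in> carrier L" "y \<in> carrier L" for x y
  proof
    assume "I +>\<^bsub>L\<^esub> x = I +>\<^bsub>L\<^esub> y"
    then have "y \<in> I +>\<^bsub>L\<^esub> x" using A.a_rcos_self that by blast
    then show "\<exists>i\<in>I. y = i \<oplus>\<^bsub>L\<^esub> x" by (auto simp: a_r_coset_def')
  next
    assume "\<exists>i\<in>I. y = i \<oplus>\<^bsub>L\<^esub> x"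
    then have "y \<in> I +>\<^bsub>L\<^esub> x" by (auto simp: a_r_coset_def')
    then show "I +>\<^bsub>L\<^esub> x = I +>\<^bsub>L\<^esub> y"
      using A.a_repr_independence' that by blast
  qed
  have mem: "z \<in> I +>\<^bsub>L\<^esub> x \<longleftrightarrow> (\<exists>i\<in>I. z = i \<oplus>\<^bsub>L\<^esub> x)" for x z
    by (auto simp: a_r_coset_def')
  have q_car: "carrier (lie_quotient L I) = (\<lambda>x. I +>\<^bsub>L\<^esub> x) ` carrier L"
    by (auto simp: lie_quotient_def FactRing_def A_RCOSETS_def' a_r_coset_def')
  have q_zero: "\<zero>\<^bsub>lie_quotient L I\<^esub> = I +>\<^bsub>L\<^esub> \<zero>\<^bsub>L\<^esub>"
    using L.M.a_coset_add_zero[OF A.a_subset] by (simp add: lie_quotient_def FactRing_def)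
  have q_add: "(I +>\<^bsub>L\<^esub> x) \<oplus>\<^bsub>lie_quotient L I\<^esub> (I +>\<^bsub>L\<^esub> y) = I +>\<^bsub>L\<^esub> (x \<oplus>\<^bsub>L\<^esub> y)"
    if "x \<in> carrier L" "y \<in> carrier L" for x y
    using A.a_rcos_sum[OF that] by (simp add: lie_quotient_def FactRing_def)
  have q_smult: "a \<odot>\<^bsub>lie_quotient L I\<^esub> (I +>\<^bsub>L\<^esub> x) = I +>\<^bsub>L\<^esub> (a \<odot>\<^bsub>L\<^esub> x)"
    if a: "a \<in> carrier K" and x: "x \<in> carrier L" for a x
  proof -
    have eq: "I +>\<^bsub>L\<^esub> (a \<odot>\<^bsub>L\<^esub> y) = I +>\<^bsub>L\<^esub> (a \<odot>\<^bsub>L\<^esub> x)" if y: "y \<in> I +>\<^bsub>L\<^esub> x" for y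
    proof -
      obtain i where i: "i \<in> I" "y = i \<oplus>\<^bsub>L\<^esub> x" using y by (auto simp: mem)
      then have "a \<odot>\<^bsub>L\<^esub> y = a \<odot>\<^bsub>L\<^esub> i \<oplus>\<^bsub>L\<^esub> a \<odot>\<^bsub>L\<^esub> x"
        using a x Isub by (simp add: L.smult_r_distr)
      then show ?thesis
        using coset[of "a \<odot>\<^bsub>L\<^esub> x" "a \<odot>\<^bsub>L\<^esub> y"] i a x Isub I.smult_closed by auto
    qed
    have "(\<Union>y\<in>I +>\<^bsub>L\<^esub> x. I +>\<^bsub>L\<^esub> (a \<odot>\<^bsub>L\<^esub> y)) = (\<Union>y\<in>I +>\<^bsub>L\<^esub> x. I +>\<^bsub>L\<^esub> (a \<odot>\<^bsub>L\<^esub> x))"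
      by (rule SUP_cong[OF HOL.refl]) (rule eq)
    also have "\<dots> = I +>\<^bsub>L\<^esub> (a \<odot>\<^bsub>L\<^esub> x)"
      using A.a_rcos_self[OF x] by (intro SUP_eq_const) auto
    finally show ?thesis by (simp add: lie_quotient_def)
  qed
  have q_br: "(I +>\<^bsub>L\<^esub> x) \<otimes>\<^bsub>lie_quotient L I\<^esub> (I +>\<^bsub>L\<^esub> y) = I +>\<^bsub>L\<^esub> (x \<otimes>\<^bsub>L\<^esub> y)"
    if x: "x \<in> carrier L" and y: "y \<in> carrier L" for x y
  proof -
    have eq: "I +>\<^bsub>L\<^esub> (x' \<otimes>\<^bsub>L\<^esub> y') = I +>\<^bsub>L\<^esub> (x \<otimes>\<^bsub>L\<^esub> y)"
      if xy: "x' \<in> I +>\<^bsub>L\<^esub> x" "y' \<in> I +>\<^bsub>L\<^esub> y" for x' y'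
    proof -
      obtain i j where ij: "i \<in> I" "x' = i \<oplus>\<^bsub>L\<^esub> x" "j \<in> I" "y' = j \<oplus>\<^bsub>L\<^esub> y"
        using xy by (auto simp: mem)
      have c: "i \<in> carrier L" "j \<in> carrier L" using ij Isub by auto
      let ?k = "i \<otimes>\<^bsub>L\<^esub> j \<oplus>\<^bsub>L\<^esub> i \<otimes>\<^bsub>L\<^esub> y \<oplus>\<^bsub>L\<^esub> x \<otimes>\<^bsub>L\<^esub> j"
      have "x' \<otimes>\<^bsub>L\<^esub> y' = i \<otimes>\<^bsub>L\<^esub> (j \<oplus>\<^bsub>L\<^esub> y) \<oplus>\<^bsub>L\<^esub> x \<otimes>\<^bsub>L\<^esub> (j \<oplus>\<^bsub>L\<^esub> y)"
        unfolding ij(2,4) by (rule bracket_add_left) (use c x y in auto)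
      also have "\<dots> = (i \<otimes>\<^bsub>L\<^esub> j \<oplus>\<^bsub>L\<^esub> i \<otimes>\<^bsub>L\<^esub> y) \<oplus>\<^bsub>L\<^esub> (x \<otimes>\<^bsub>L\<^esub> j \<oplus>\<^bsub>L\<^esub> x \<otimes>\<^bsub>L\<^esub> y)"
        by (simp only: bracket_add_right c x y)
      also have "\<dots> = ?k \<oplus>\<^bsub>L\<^esub> x \<otimes>\<^bsub>L\<^esub> y"
        by (rule L.M.a_assoc[symmetric]) (use c x y in auto)
      finally have "x' \<otimes>\<^bsub>L\<^esub> y' = ?k \<oplus>\<^bsub>L\<^esub> x \<otimes>\<^bsub>L\<^esub> y" .
      moreover have "?k \<in> I"
        using ij c x y br br' A.a_closed by auto
      ultimately show ?thesis
        using coset[of "x \<otimes>\<^bsub>L\<^esub> y" "x' \<otimes>\<^bsub>L\<^esub> y'"] ij c x y by auto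
    qed
    have "rcoset_mult L I (I +>\<^bsub>L\<^esub> x) (I +>\<^bsub>L\<^esub> y) =
      (\<Union>x'\<in>I +>\<^bsub>L\<^esub> x. \<Union>y'\<in>I +>\<^bsub>L\<^esub> y. I +>\<^bsub>L\<^esub> (x \<otimes>\<^bsub>L\<^esub> y))"
      unfolding rcoset_mult_def by (rule SUP_cong[OF HOL.refl], rule SUP_cong[OF HOL.refl]) (rule eq)
    also have "\<dots> = I +>\<^bsub>L\<^esub> (x \<otimes>\<^bsub>L\<^esub> y)"
      using A.a_rcos_self[OF x] A.a_rcos_self[OF y] by auto
    finally show ?thesis by (simp add: lie_quotient_def FactRing_def)
  qed
  have ab: "abelian_group (lie_quotient L I)"
  proof (rule abelian_groupI)
    fix C assume "C \<in> carrier (lie_quotient L I)"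
    then obtain x where x: "x \<in> carrier L" "C = I +>\<^bsub>L\<^esub> x" by (auto simp: q_car)
    then show "\<exists>D\<in>carrier (lie_quotient L I). D \<oplus>\<^bsub>lie_quotient L I\<^esub> C = \<zero>\<^bsub>lie_quotient L I\<^esub>"
      by (intro bexI[of _ "I +>\<^bsub>L\<^esub> (\<ominus>\<^bsub>L\<^esub> x)"]) (auto simp: q_car q_add q_zero L.M.l_neg)
  qed (auto simp: q_car q_add q_zero L.M.a_ac)
  show ?thesis
    apply (intro lie_algebra.intro lie_algebra_axioms.intro moduleI K.field_axioms
        K.is_cring ab)
                   apply (auto simp: q_car q_zero q_add q_smult q_br L.smult_l_distr L.smult_r_distr
        L.smult_assoc1 bracket_add_left bracket_add_right bracket_smult_left bracket_smult_right
        bracket_self jacobi)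
    done
qed

lemma (in lie_algebra) submodule_bracket_span:
  assumes "A \<subseteq> carrier L" "B \<subseteq> carrier L"
  shows "submodule (bracket_span K L A B) K L"
proof (rule L.submoduleI)
  let ?S = "{x \<otimes>\<^bsub>L\<^esub> y | x y. x \<in> A \<and> y \<in> B}"
  have car: "submodule (carrier L) K L" "?S \<subseteq> carrier L"
    using L.carrier_is_submodule assms by auto
  note E = L.submoduleE
  show "bracket_span K L A B \<subseteq> carrier L"
    using car unfolding bracket_span_def hull_def by blast
  show "\<zero>\<^bsub>L\<^esub> \<in> bracket_span K L A B"
    using submodule.axioms(1)[THEN subgroup.one_closed, of _ K L]
    unfolding bracket_span_def hull_def by auto
  show "\<ominus>\<^bsub>L\<^esub> x \<in> bracket_span K L A B" if "x \<in> bracket_span K L A B" for x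
    using that E(3) unfolding bracket_span_def hull_def by blast
  show "x \<oplus>\<^bsub>L\<^esub> y \<in> bracket_span K L A B"
    if "x \<in> bracket_span K L A B" "y \<in> bracket_span K L A B" for x y
    using that E(5) unfolding bracket_span_def hull_def by blast
  show "a \<odot>\<^bsub>L\<^esub> x \<in> bracket_span K L A B"
    if "a \<in> carrier K" "x \<in> bracket_span K L A B" for a x
    using that E(4) unfolding bracket_span_def hull_def by blast
qed

lemma bracket_span_subset:
  assumes "submodule N K L" "\<And>x y. x \<in> A \<Longrightarrow> y \<in> B \<Longrightarrow> x \<otimes>\<^bsub>L\<^esub> y \<in> N"
  shows "bracket_span K L A B \<subseteq> N"
  unfolding bracket_span_def using assms by (intro hull_minimal) auto

lemma bracket_in_bracket_span: "x \<in> A \<Longrightarrow> y \<in> B \<Longrightarrow> x \<otimes>\<^bsub>L\<^esub> y \<in> bracket_span K L A B"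
  unfolding bracket_span_def by (rule hull_inc) blast

lemma (in lie_algebra) lower_central_ideal:
  "submodule (lower_central K L n) K L \<and>
   (\<forall>x \<in> carrier L. \<forall>y \<in> lower_central K L n. x \<otimes>\<^bsub>L\<^esub> y \<in> lower_central K L n)"
proof (induction n)
  case 0
  then show ?case by (simp add: L.carrier_is_submodule)
next
  case (Suc n)
  let ?B = "lower_central K L n"
  have sub: "?B \<subseteq> carrier L"
    using Suc L.submoduleE(1) by blast
  have le: "bracket_span K L (carrier L) ?B \<subseteq> ?B"
    using Suc by (intro bracket_span_subset) auto
  have "submodule (bracket_span K L (carrier L) ?B) K L"
    using sub by (intro submodule_bracket_span) auto
  then show ?case
    using le L.carrier_is_submodule by (cases n) (auto intro: bracket_in_bracket_span)
qed

lemma lie_algebra_free_nilpotent: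
  "lie_algebra scalars (free_nilpotent c :: ('k::field, ('k, 'x) free_lie set) module)"
  unfolding free_nilpotent_def
  using lie_algebra.lie_algebra_quotient[OF lie_algebra_free]
    lie_algebra.lower_central_ideal[OF lie_algebra_free] by blast

end

theory Submission
  imports Defs
begin

text \<open>
  Let $F$ be the free Lie algebra on the three generators, embedded in the noncommutative power
  series; the image of $F^n$ consists of the Lie elements without words shorter than $n$. It
  suffices that every product of two generators lies in $F^c$ modulo $F^{c+1}$, and this is shown
  one degree at a time.

  \<^item> Degree 1: commutativity and the derivation rule alone, applied to $[a,b]\cdot[a,d]$ in both
    orders, give $[a\cdot a,[b,d]]+[a\cdot b,[d,a]]+[a\cdot d,[a,b]]=0$. In degree 3 the only such
    relation is the Jacobi identity, so every generator acts on the generators as a scalar up to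
    $F^2$, and commutativity makes this scalar zero.
  \<^item> Degree 2: the degree 3 part of $[x,y]\cdot z=x\cdot(y\cdot z)-y\cdot(x\cdot z)$ is a system of
    equations, with a linear and a quadratic part, for the tensor describing the product; suitable
    contractions force this tensor to vanish.
  \<^item> Degree $d\ge 3$: now the right-hand side of that identity has degree at least $2d-1>d+1$, so the
    leading part $\varphi$ of the product satisfies $[\varphi(x,y),z]=[\varphi(x,z),y]$. Comparing
    words cyclically, $\varphi(x,y)$ only involves the letters $y,z$. As $z$ can be any letter other
    than $y$, it is a multiple of $y^d$, which is not a Lie element.
\<close>

section \<open>Word coefficients\<close>

text \<open>The Cauchy product of noncommutative power series: \<open>a u * b v\<close> summed over
  all factorisations of the word as \<open>u @ v\<close>. The recursion shifts the first letter into
  \<open>a\<close>.\<close>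

primrec tmul :: "('x list \<Rightarrow> 'k::field) \<Rightarrow> ('x list \<Rightarrow> 'k) \<Rightarrow> 'x list \<Rightarrow> 'k" where
  "tmul a b [] = a [] * b []"
| "tmul a b (x # w) = a [] * b (x # w) + tmul (\<lambda>v. a (x # v)) b w"

lemma tmul_add_left: "tmul (\<lambda>v. a v + a' v) b w = tmul a b w + tmul a' b w"
  by (induction w arbitrary: a a') (simp_all add: algebra_simps)

lemma tmul_add_right: "tmul a (\<lambda>v. b v + b' v) w = tmul a b w + tmul a b' w"
  by (induction w arbitrary: a) (simp_all add: algebra_simps)

lemma tmul_scale_left: "tmul (\<lambda>v. k * a v) b w = k * tmul a b w"
  by (induction w arbitrary: a) (simp_all add: algebra_simps)

lemma tmul_scale_right: "tmul a (\<lambda>v. k * b v) w = k * tmul a b w"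
  by (induction w arbitrary: a) (simp_all add: algebra_simps)

lemma tmul_diff_left: "tmul (\<lambda>v. a v - a' v) b w = tmul a b w - tmul a' b w"
  by (induction w arbitrary: a a') (simp_all add: algebra_simps)

lemma tmul_diff_right: "tmul a (\<lambda>v. b v - b' v) w = tmul a b w - tmul a b' w"
  by (induction w arbitrary: a) (simp_all add: algebra_simps)

lemma tmul_assoc: "tmul (tmul a b) d w = tmul a (tmul b d) w"
  by (induction w arbitrary: a)
    (simp_all add: tmul_add_left tmul_scale_left algebra_simps)

lemma tmul_zero_left: "tmul (\<lambda>v. 0) b w = 0"
  by (induction w) simp_all

text \<open>In every factorisation of \<open>w\<close> one of the two factors is too short.\<close>

lemma tmul_vanish:
  assumes "\<And>v. length v < m \<Longrightarrow> a v = 0" "\<And>v. length v < n \<Longrightarrow> b v = 0" "length w < m + n"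
  shows "tmul a b w = 0"
  using assms
proof (induction w arbitrary: a m)
  case Nil
  then show ?case by (cases m) auto
next
  case (Cons x w)
  show ?case
  proof (cases m)
    case 0
    then have "tmul (\<lambda>v. a (x # v)) b w = 0"
      by (intro Cons.IH[of 0]) (use Cons.prems in auto)
    then show ?thesis using Cons.prems 0 by auto
  next
    case (Suc m')
    have "tmul (\<lambda>v. a (x # v)) b w = 0"
      by (intro Cons.IH[of m']) (use Cons.prems Suc in auto)
    then show ?thesis using Cons.prems Suc by auto
  qed
qed

text \<open>The expansion of a Lie term in the noncommutative power series, with brackets read as
  commutators.\<close>

primrec term_coef :: "('k::field, 'x) lie_term \<Rightarrow> 'x list \<Rightarrow> 'k" where
  "term_coef (TGen x) = (\<lambda>w. if w = [x] then 1 else 0)"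
| "term_coef TZero = (\<lambda>w. 0)"
| "term_coef (TAdd s t) = (\<lambda>w. term_coef s w + term_coef t w)"
| "term_coef (TNeg s) = (\<lambda>w. - term_coef s w)"
| "term_coef (TSmult k s) = (\<lambda>w. k * term_coef s w)"
| "term_coef (TBracket s t) =
    (\<lambda>w. tmul (term_coef s) (term_coef t) w - tmul (term_coef t) (term_coef s) w)"

text \<open>Commutators in an associative algebra satisfy the Lie axioms; \<open>tmul_assoc\<close>
  is what yields the Jacobi identity.\<close>

lemma term_coef_lie_eq: "lie_eq s t \<Longrightarrow> term_coef s = term_coef t"
proof (induction rule: lie_eq.induct)
  case (cong_bracket s s' t t')
  then show ?case by simp
qed (simp_all add: fun_eq_iff tmul_add_left tmul_add_right tmul_scale_left tmul_scale_right
      tmul_diff_left tmul_diff_right tmul_assoc algebra_simps)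

lift_definition coef :: "('k::field, 'x) free_lie \<Rightarrow> 'x list \<Rightarrow> 'k" is term_coef
  by (rule term_coef_lie_eq)

lemma coef_gen: "coef (lie_gen x) w = (if w = [x] then 1 else 0)"
  by transfer simp

lemma coef_zero [simp]: "coef 0 w = 0"
  by transfer simp

lemma coef_add [simp]: "coef (u + v) w = coef u w + coef v w"
  by transfer simp

lemma coef_uminus [simp]: "coef (- u) w = - coef u w"
  by transfer simp

lemma coef_diff [simp]: "coef (u - v) w = coef u w - coef v w"
  using coef_add[of u "- v" w] by simp

lemma coef_smult [simp]: "coef (lie_smult k u) w = k * coef u w"
  by transfer simp

lemma coef_bracket:
  "coef (lie_bracket u v) w = tmul (coef u) (coef v) w - tmul (coef v) (coef u) w"
  by transfer simp

lemma coef_sum [simp]: "coef (sum f S) w = (\<Sum>i\<in>S. coef (f i) w)"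
  by (induction S rule: infinite_finite_induct) simp_all

lemma coef_Nil [simp]: "coef u [] = 0"
proof (transfer)
  fix u :: "('a, 'b) lie_term"
  show "term_coef u [] = 0" by (induction u) simp_all
qed

lemma coef_bracket1 [simp]: "coef (lie_bracket u v) [i] = 0"
  by (simp add: coef_bracket)

lemma coef_bracket2:
  "coef (lie_bracket u v) [i, j] = coef u [i] * coef v [j] - coef v [i] * coef u [j]"
  by (simp add: coef_bracket)

lemma coef_bracket3:
  "coef (lie_bracket u v) [i, j, k] =
    coef u [i] * coef v [j, k] + coef u [i, j] * coef v [k]
    - coef v [i] * coef u [j, k] - coef v [i, j] * coef u [k]"
  by (simp add: coef_bracket)

lemma tmul_letter_left:
  "tmul (\<lambda>w. if w = [x] then 1 else 0) b w = (if w \<noteq> [] \<and> hd w = x then b (tl w) else 0)"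
proof (cases w)
  case (Cons y v)
  have "tmul (\<lambda>w. if w = [] then 1 else 0) b v = b v"
    by (cases v) (simp_all add: tmul_zero_left)
  then show ?thesis using Cons by (simp add: tmul_zero_left)
qed simp

lemma tmul_letter_right:
  "tmul a (\<lambda>w. if w = [x] then 1 else 0) w = (if w \<noteq> [] \<and> last w = x then a (butlast w) else 0)"
proof (induction w arbitrary: a)
  case (Cons y v)
  then show ?case by (cases "v = []") simp_all
qed simp

lemma coef_bracket_gen:
  "coef (lie_bracket (lie_gen x) v) w =
    (if w \<noteq> [] \<and> hd w = x then coef v (tl w) else 0)
    - (if w \<noteq> [] \<and> last w = x then coef v (butlast w) else 0)"
  by (simp add: coef_bracket coef_gen[abs_def] tmul_letter_left tmul_letter_right)

lemma coef_bracket_vanish: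
  assumes "\<And>w. length w < m \<Longrightarrow> coef u w = 0" "\<And>w. length w < n \<Longrightarrow> coef v w = 0"
    and "length w < m + n"
  shows "coef (lie_bracket u v) w = 0"
  using tmul_vanish[of m "coef u" n "coef v" w] tmul_vanish[of n "coef v" m "coef u" w] assms
  by (simp add: coef_bracket)

text \<open>A Lie element has no constant term, so \<open>u\<close> contributes at least one
  letter.\<close>

lemma coef_bracket_vanish_Suc:
  assumes "\<And>w. length w < n \<Longrightarrow> coef v w = 0" "length w < Suc n"
  shows "coef (lie_bracket u v) w = 0"
  by (rule coef_bracket_vanish[of 1 _ n]) (use assms in auto)


section \<open>The lower central series\<close>

lemma bracket_add_l: "lie_bracket (u + v) w = lie_bracket u w + lie_bracket v w"
  by transfer (rule lie_eq.br_add_left)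

lemma bracket_add_r: "lie_bracket u (v + w) = lie_bracket u v + lie_bracket u w"
  by transfer (rule lie_eq.br_add_right)

lemma bracket_smult_l: "lie_bracket (lie_smult k u) v = lie_smult k (lie_bracket u v)"
  by transfer (rule lie_eq.br_smult_left)

lemma bracket_smult_r: "lie_bracket u (lie_smult k v) = lie_smult k (lie_bracket u v)"
  by transfer (rule lie_eq.br_smult_right)

lemma bracket_self_zero [simp]: "lie_bracket u u = 0"
  by transfer (rule lie_eq.br_self)

lemma lie_jacobi:
  "lie_bracket u (lie_bracket v w) + lie_bracket v (lie_bracket w u)
    + lie_bracket w (lie_bracket u v) = 0"
  by transfer (rule lie_eq.br_jacobi)

lemma bracket_anti: "lie_bracket u v = - lie_bracket v u"
proof -
  have "lie_bracket (u + v) (u + v) = 0" by (rule bracket_self_zero)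
  then show ?thesis
    unfolding bracket_add_l bracket_add_r by (simp add: eq_neg_iff_add_eq_0 add.commute)
qed

interpretation FL: vector_space "lie_smult :: 'k::field \<Rightarrow> ('k, 'x) free_lie \<Rightarrow> ('k, 'x) free_lie"
proof
  fix a b :: 'k and x y :: "('k, 'x) free_lie"
  show "lie_smult a (x + y) = lie_smult a x + lie_smult a y"
    by transfer (rule lie_eq.smult_add_right)
  show "lie_smult (a + b) x = lie_smult a x + lie_smult b x"
    by transfer (rule lie_eq.smult_add_left)
  show "lie_smult a (lie_smult b x) = lie_smult (a * b) x"
    by transfer (rule lie_eq.sym[OF lie_eq.smult_smult])
  show "lie_smult 1 x = x"
    by transfer (rule lie_eq.smult_1)
qed

lemma bracket_0_l [simp]: "lie_bracket 0 v = 0"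
  using bracket_add_l[of 0 0 v] by simp

lemma bracket_0_r [simp]: "lie_bracket v 0 = 0"
  using bracket_add_r[of v 0 0] by simp

lemma bracket_sum_r: "lie_bracket u (sum f S) = (\<Sum>i\<in>S. lie_bracket u (f i))"
  by (induction S rule: infinite_finite_induct) (simp_all add: bracket_add_r)

lemma bracket_uminus_r: "lie_bracket u (- v) = - lie_bracket u v"
  using bracket_add_r[of u v "- v"] by (simp add: eq_neg_iff_add_eq_0 add.commute)

lemma bracket_diff_r: "lie_bracket u (v - w) = lie_bracket u v - lie_bracket u w"
  using bracket_add_r[of u v "- w"] by (simp add: bracket_uminus_r)

lemma lie_jacobi_derivation:
  "lie_bracket (lie_bracket u v) w = lie_bracket u (lie_bracket v w) - lie_bracket v (lie_bracket u w)"
proof -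
  have "lie_bracket w (lie_bracket u v) = - lie_bracket (lie_bracket u v) w"
    by (rule bracket_anti)
  moreover have "lie_bracket v (lie_bracket w u) = - lie_bracket v (lie_bracket u w)"
    by (subst bracket_anti[of w u]) (simp add: bracket_uminus_r)
  ultimately show ?thesis using lie_jacobi[of u v w] by (simp add: algebra_simps)
qed

section \<open>Right-normed brackets span the free Lie algebra\<close>

fun right_normed :: "'x list \<Rightarrow> ('k::field, 'x) free_lie" where
  "right_normed [] = 0"
| "right_normed [x] = lie_gen x"
| "right_normed (x # y # w) = lie_bracket (lie_gen x) (right_normed (y # w))"

lemma right_normed_Cons:
  "w \<noteq> [] \<Longrightarrow> right_normed (x # w) = lie_bracket (lie_gen x) (right_normed w)"
  by (cases w) simp_all

lemma bracket_gen_span: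
  assumes "v \<in> FL.span (range right_normed)"
  shows "lie_bracket (lie_gen x) v \<in> FL.span (range right_normed)"
  using assms
proof (induction rule: FL.span_induct_alt)
  case base
  then show ?case by (simp add: FL.span_zero)
next
  case (step k y z)
  then obtain w where w: "y = right_normed w" by auto
  have "lie_bracket (lie_gen x) y \<in> FL.span (range right_normed)"
    by (cases "w = []") (auto simp: w FL.span_zero right_normed_Cons[symmetric]
        intro: FL.span_base)
  then show ?case using step by (simp add: bracket_add_r bracket_smult_r FL.span_add FL.span_scale)
qed

text \<open>The derivation form of the Jacobi identity unfolds the bracket with a right-normed word
  into successive brackets with single generators, and these preserve the span.\<close>

lemma bracket_right_normed_span:
  "v \<in> FL.span (range right_normed) \<Longrightarrow>
    lie_bracket (right_normed w) v \<in> FL.span (range right_normed)"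
  by (induction w arbitrary: v rule: right_normed.induct)
    (simp_all add: FL.span_zero bracket_gen_span lie_jacobi_derivation FL.span_diff)

lemma bracket_span:
  assumes "u \<in> FL.span (range right_normed)" "v \<in> FL.span (range right_normed)"
  shows "lie_bracket u v \<in> FL.span (range right_normed)"
  using assms(1)
proof (induction rule: FL.span_induct_alt)
  case base
  then show ?case by (simp add: FL.span_zero)
next
  case (step k y z)
  then show ?case
    using assms(2) bracket_right_normed_span
    by (auto simp: bracket_add_l bracket_smult_l intro!: FL.span_add FL.span_scale)
qed

lemma span_right_normed: "(u :: ('a::field, 'b) free_lie) \<in> FL.span (range right_normed)"
proof -
  have "abs_free_lie t \<in> FL.span (range right_normed)" for t :: "('a, 'b) lie_term"
  proof (induction t)
    case (TGen x)
    have "lie_gen x = right_normed [x]" by simp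
    then show ?case by (metis FL.span_base lie_gen.abs_eq rangeI)
  next
    case TZero
    then show ?case by (metis FL.span_zero zero_free_lie.abs_eq)
  next
    case (TAdd s t)
    then show ?case by (metis FL.span_add plus_free_lie.abs_eq)
  next
    case (TNeg s)
    then show ?case by (metis FL.span_neg uminus_free_lie.abs_eq)
  next
    case (TSmult k s)
    then show ?case by (metis FL.span_scale lie_smult.abs_eq)
  next
    case (TBracket s t)
    then show ?case by (metis bracket_span lie_bracket.abs_eq)
  qed
  then show ?thesis by (induction u)
qed

lemma coef_right_normed: "length v \<noteq> length w \<Longrightarrow> coef (right_normed w) v = 0"
proof (induction w arbitrary: v rule: right_normed.induct)
  case (3 x y w)
  then show ?case by (cases v) (auto simp: coef_bracket_gen)
qed (auto simp: coef_gen)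

text \<open>In a bracket of a generator with \<open>v\<close>, the two terms of the commutator have
  equal coefficients at a constant word and cancel. This is why a power of a letter of degree at
  least 2 is not a Lie element.\<close>

lemma coef_replicate:
  assumes "n \<ge> 2"
  shows "coef u (replicate n x) = 0"
  using span_right_normed[of u]
proof (induction rule: FL.span_induct_alt)
  case (step k y z)
  then obtain w where w: "y = right_normed w" by auto
  have eq: "butlast (replicate n x) = replicate (n - Suc 0) x"
    using assms by (simp add: butlast_conv_take)
  have neq: "replicate n x \<noteq> [z]" for z
    using assms by (auto simp: numeral_2_eq_2 Suc_le_eq gr0_conv_Suc less_iff_Suc_add)
  have "coef y (replicate n x) = 0"
    using w assms
    by (cases w rule: right_normed.cases) (auto simp: coef_gen coef_bracket_gen eq neq last_replicate)
  then show ?case using step by simp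
qed simp

section \<open>The Dynkin-Specht-Wever identity\<close>

definition ad_word :: "'x list \<Rightarrow> ('k::field, 'x) free_lie \<Rightarrow> ('k, 'x) free_lie" where
  "ad_word w u = foldr (\<lambda>x. lie_bracket (lie_gen x)) w u"

lemma ad_word_Cons: "ad_word (x # w) u = lie_bracket (lie_gen x) (ad_word w u)"
  by (simp add: ad_word_def)

lemma ad_word_snoc: "ad_word (w @ [x]) u = ad_word w (lie_bracket (lie_gen x) u)"
  by (simp add: ad_word_def)

lemma right_normed_snoc: "right_normed (w @ [x]) = ad_word w (lie_gen x)"
proof (induction w)
  case (Cons y w)
  then show ?case by (cases w) (simp_all add: ad_word_def)
qed (simp add: ad_word_def)

lemma finite_words:
  assumes "finite (UNIV :: 'x set)"
  shows "finite {w :: 'x list. length w = n}"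
  using finite_lists_length_eq[OF assms, of n] by simp

lemma sum_words_Cons:
  fixes x :: 'x and g :: "'x list \<Rightarrow> 'b::comm_monoid_add"
  assumes fin: "finite (UNIV :: 'x set)"
    and "\<And>w. hd w \<noteq> x \<Longrightarrow> length w = Suc n \<Longrightarrow> g w = 0"
  shows "(\<Sum>w | length w = Suc n. g w) = (\<Sum>w | length w = n. g (x # w))"
proof -
  have "(\<Sum>w | length w = Suc n. g w) = (\<Sum>w\<in>(\<lambda>w. x # w) ` {w. length w = n}. g w)"
  proof (rule sum.mono_neutral_right)
    show "\<forall>w\<in>{w. length w = Suc n} - (\<lambda>w. x # w) ` {w. length w = n}. g w = 0"
    proof
      fix w assume w: "w \<in> {w. length w = Suc n} - (\<lambda>w. x # w) ` {w. length w = n}"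
      then have "hd w \<noteq> x"
        by (cases w rule: list.exhaust) auto
      then show "g w = 0" using w assms(2) by blast
    qed
  qed (auto simp: finite_words[OF fin])
  also have "\<dots> = (\<Sum>w | length w = n. g (x # w))"
    by (subst sum.reindex) (auto simp: inj_on_def)
  finally show ?thesis .
qed

lemma sum_words_snoc:
  fixes x :: 'x and g :: "'x list \<Rightarrow> 'b::comm_monoid_add"
  assumes fin: "finite (UNIV :: 'x set)"
    and "\<And>w. last w \<noteq> x \<Longrightarrow> length w = Suc n \<Longrightarrow> g w = 0"
  shows "(\<Sum>w | length w = Suc n. g w) = (\<Sum>w | length w = n. g (w @ [x]))"
proof -
  have "(\<Sum>w | length w = Suc n. g w) = (\<Sum>w\<in>(\<lambda>w. w @ [x]) ` {w. length w = n}. g w)"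
  proof (rule sum.mono_neutral_right)
    show "\<forall>w\<in>{w. length w = Suc n} - (\<lambda>w. w @ [x]) ` {w. length w = n}. g w = 0"
    proof
      fix w assume w: "w \<in> {w. length w = Suc n} - (\<lambda>w. w @ [x]) ` {w. length w = n}"
      then have "last w \<noteq> x"
        by (cases w rule: rev_cases) auto
      then show "g w = 0" using w assms(2) by blast
    qed
  qed (auto simp: finite_words[OF fin])
  also have "\<dots> = (\<Sum>w | length w = n. g (w @ [x]))"
    by (subst sum.reindex) (auto simp: inj_on_def)
  finally show ?thesis .
qed

text \<open>The two terms of the commutator are supported on words that begin, respectively end,
  with \<open>x\<close>; deleting this letter reindexes both sums.\<close>

lemma sum_coef_bracket_gen:
  fixes v :: "('k::field, 'x) free_lie" and g :: "'x list \<Rightarrow> ('k, 'x) free_lie"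
  assumes fin: "finite (UNIV :: 'x set)"
  shows "(\<Sum>w | length w = Suc n. lie_smult (coef (lie_bracket (lie_gen x) v) w) (g w)) =
    (\<Sum>w | length w = n. lie_smult (coef v w) (g (x # w)))
    - (\<Sum>w | length w = n. lie_smult (coef v w) (g (w @ [x])))"
proof -
  let ?h = "\<lambda>w. if w \<noteq> [] \<and> hd w = x then coef v (tl w) else 0"
  let ?l = "\<lambda>w. if w \<noteq> [] \<and> last w = x then coef v (butlast w) else 0"
  have "(\<Sum>w | length w = Suc n. lie_smult (coef (lie_bracket (lie_gen x) v) w) (g w)) =
    (\<Sum>w | length w = Suc n. lie_smult (?h w) (g w))
    - (\<Sum>w | length w = Suc n. lie_smult (?l w) (g w))"
    unfolding coef_bracket_gen FL.scale_left_diff_distrib by (rule sum_subtractf)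
  moreover have "(\<Sum>w | length w = Suc n. lie_smult (?h w) (g w)) =
    (\<Sum>w | length w = n. lie_smult (coef v w) (g (x # w)))"
    by (subst sum_words_Cons[OF fin, where x = x]) auto
  moreover have "(\<Sum>w | length w = Suc n. lie_smult (?l w) (g w)) =
    (\<Sum>w | length w = n. lie_smult (coef v w) (g (w @ [x])))"
    by (subst sum_words_snoc[OF fin, where x = x]) auto
  ultimately show ?thesis by simp
qed

lemma sum_coef_gen:
  fixes g :: "'x list \<Rightarrow> ('k::field, 'x) free_lie"
  assumes fin: "finite (UNIV :: 'x set)"
  shows "(\<Sum>w | length w = Suc 0. lie_smult (coef (lie_gen x) w) (g w)) = g [x]"
proof -
  have "(\<Sum>w | length w = Suc 0. lie_smult (coef (lie_gen x) w) (g w)) =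
    (\<Sum>w\<in>{[x]}. lie_smult (coef (lie_gen x) w) (g w))"
    by (rule sum.mono_neutral_right) (auto simp: coef_gen finite_words[OF fin])
  then show ?thesis by (simp add: coef_gen)
qed

text \<open>Through \<open>ad_word\<close> the free associative algebra acts on the free Lie
  algebra. The expansion of a Lie element then acts as the bracket with this element, since the
  adjoint representation turns brackets into commutators.\<close>

lemma sum_ad_word:
  fixes z :: "('k::field, 'x) free_lie"
  assumes fin: "finite (UNIV :: 'x set)"
  shows "(\<Sum>a | length a = length w. lie_smult (coef (right_normed w) a) (ad_word a z)) =
    lie_bracket (right_normed w) z"
proof (induction w arbitrary: z rule: right_normed.induct)
  case (2 x)
  then show ?case using sum_coef_gen[OF fin, where x = x and g = "\<lambda>a. ad_word a z"] by (simp add: ad_word_def)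
next
  case (3 x y w)
  have "(\<Sum>a | length a = length (x # y # w).
      lie_smult (coef (right_normed (x # y # w)) a) (ad_word a z)) =
    (\<Sum>a | length a = length (y # w). lie_smult (coef (right_normed (y # w)) a) (ad_word (x # a) z))
    - (\<Sum>a | length a = length (y # w). lie_smult (coef (right_normed (y # w)) a) (ad_word (a @ [x]) z))"
    using sum_coef_bracket_gen[OF fin, where n = "length (y # w)" and x = x and v = "right_normed (y # w)"
        and g = "\<lambda>a. ad_word a z"] by simp
  also have "\<dots> = lie_bracket (lie_gen x) (lie_bracket (right_normed (y # w)) z)
    - lie_bracket (right_normed (y # w)) (lie_bracket (lie_gen x) z)"
    unfolding ad_word_snoc ad_word_Cons 3 bracket_smult_r[symmetric] bracket_sum_r[symmetric] ..
  finally show ?case by (simp add: lie_jacobi_derivation)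
qed simp

text \<open>In characteristic zero this makes \<^const>\<open>coef\<close> injective, so the Poincare--Birkhoff--Witt
  theorem is not needed.\<close>

lemma dynkin_specht_wever:
  assumes fin: "finite (UNIV :: 'x set)"
  shows "(\<Sum>a | length a = length w. lie_smult (coef (right_normed w) a) (right_normed a)) =
    lie_smult (of_nat (length w)) (right_normed w :: ('k::field, 'x) free_lie)"
proof (induction w rule: right_normed.induct)
  case (2 x)
  then show ?case using sum_coef_gen[OF fin, where x = x and g = right_normed] by simp
next
  case (3 x y w)
  let ?n = "length (y # w)" and ?v = "right_normed (y # w) :: ('k, 'x) free_lie"
  have "(\<Sum>a | length a = length (x # y # w).
      lie_smult (coef (right_normed (x # y # w)) a) (right_normed a :: ('k, 'x) free_lie)) =
    (\<Sum>a | length a = ?n. lie_smult (coef ?v a) (right_normed (x # a)))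
    - (\<Sum>a | length a = ?n. lie_smult (coef ?v a) (right_normed (a @ [x])))"
    using sum_coef_bracket_gen[OF fin, where n = ?n and x = x and v = ?v and g = right_normed] by simp
  also have "(\<Sum>a | length a = ?n. lie_smult (coef ?v a) (right_normed (x # a))) =
    lie_bracket (lie_gen x) (\<Sum>a | length a = ?n. lie_smult (coef ?v a) (right_normed a))"
    unfolding bracket_sum_r bracket_smult_r
    by (rule sum.cong) (auto simp: right_normed_Cons length_Suc_conv)
  also have "\<dots> = lie_smult (of_nat ?n) (lie_bracket (lie_gen x) ?v)"
    unfolding 3 bracket_smult_r ..
  \<comment> \<open>By \<open>right_normed_snoc\<close> this is the adjoint action of
    \<open>?v\<close> on the generator, that is $[v,x]=-[x,v]$. Subtracting it raises the factor
    from \<open>?n\<close> to \<open>?n + 1\<close>.\<close>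
  also have "(\<Sum>a | length a = ?n. lie_smult (coef ?v a) (right_normed (a @ [x]))) =
    lie_bracket ?v (lie_gen x)"
    unfolding right_normed_snoc by (rule sum_ad_word[OF fin])
  also have "\<dots> = - lie_bracket (lie_gen x) ?v"
    by (rule bracket_anti)
  also have "lie_smult (of_nat ?n) (lie_bracket (lie_gen x) ?v) - - lie_bracket (lie_gen x) ?v =
    lie_smult (of_nat ?n + 1) (lie_bracket (lie_gen x) ?v)"
    by (simp only: FL.scale_left_distrib FL.scale_one diff_minus_eq_add)
  finally show ?case by (simp add: add_ac)
qed simp

text \<open>Sort an expansion of \<open>u\<close> in right-normed words by word length. By
  \<open>dynkin_specht_wever\<close> the coefficients of \<open>u\<close> at words of length
  \<open>m\<close> determine \<open>m\<close> times the component \<open>H m\<close>, so in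
  characteristic zero their vanishing kills this component.\<close>

lemma coef_vanish_span:
  fixes u :: "('k::field_char_0, 'x) free_lie"
  assumes fin: "finite (UNIV :: 'x set)"
    and vanish: "\<And>w. length w < n \<Longrightarrow> coef u w = 0"
  shows "u \<in> FL.span (right_normed ` {w. n \<le> length w})"
proof -
  obtain S r where S: "finite S" "S \<subseteq> range (right_normed :: 'x list \<Rightarrow> ('k, 'x) free_lie)"
    and u: "u = (\<Sum>a\<in>S. lie_smult (r a) a)"
    using span_right_normed[of u] unfolding FL.span_explicit by blast
  \<comment> \<open>As \<open>right_normed\<close> is not injective, \<open>f\<close> picks one word
    for each element of \<open>S\<close>; its length serves as the degree.\<close>
  obtain f where f: "\<And>a. a \<in> S \<Longrightarrow> right_normed (f a) = a"
    using S(2) by (metis f_inv_into_f subset_iff)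
  define H where "H m = (\<Sum>a | a \<in> S \<and> length (f a) = m. lie_smult (r a) a)" for m
  have D: "(\<Sum>w | length w = m. lie_smult (coef u w) (right_normed w)) = lie_smult (of_nat m) (H m)"
    for m
  proof -
    have "(\<Sum>w | length w = m. lie_smult (coef u w) (right_normed w)) =
      (\<Sum>w | length w = m. \<Sum>a\<in>S. lie_smult (r a) (lie_smult (coef a w) (right_normed w)))"
      by (simp add: u FL.scale_sum_left)
    also have "\<dots> = (\<Sum>a\<in>S. lie_smult (r a)
        (\<Sum>w | length w = m. lie_smult (coef a w) (right_normed w)))"
      unfolding FL.scale_sum_right by (rule sum.swap)
    also have "\<dots> = (\<Sum>a\<in>S. if length (f a) = m then lie_smult (of_nat m) (lie_smult (r a) a) else 0)"
    proof (rule sum.cong[OF HOL.refl])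
      fix a assume a: "a \<in> S"
      show "lie_smult (r a) (\<Sum>w | length w = m. lie_smult (coef a w) (right_normed w)) =
        (if length (f a) = m then lie_smult (of_nat m) (lie_smult (r a) a) else 0)"
      proof (cases "length (f a) = m")
        case True
        then show ?thesis
          using dynkin_specht_wever[OF fin, where w = "f a" and 'k = 'k] by (simp add: f[OF a] mult.commute)
      next
        case False
        then have "coef (right_normed (f a) :: ('k, 'x) free_lie) w = 0" if "length w = m" for w
          using that by (intro coef_right_normed) simp
        then have "coef a w = 0" if "length w = m" for w
          using that by (simp add: f[OF a])
        then show ?thesis using False by simp
      qed
    qed
    also have "\<dots> = lie_smult (of_nat m) (H m)"
      unfolding H_def FL.scale_sum_right by (rule sum.inter_filter[OF S(1), symmetric])
    finally show ?thesis .
  qed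
  have H0: "H m = 0" if "m < n" for m
  proof (cases m)
    \<comment> \<open>The factor \<open>m = 0\<close> gives no information here, but
      \<open>right_normed []\<close> is zero by definition.\<close>
    case 0
    have "a = 0" if "a \<in> S" "length (f a) = 0" for a
      using f[OF that(1)] that(2) by simp
    then show ?thesis unfolding H_def 0 by (intro sum.neutral) auto
  next
    case (Suc k)
    then have "(of_nat m :: 'k) \<noteq> 0" by (simp only: of_nat_eq_0_iff)
    moreover have "lie_smult (of_nat m) (H m) = 0"
      unfolding D[symmetric] using that by (intro sum.neutral) (auto simp: vanish)
    ultimately show ?thesis by simp
  qed
  have "u = (\<Sum>m\<in>(length \<circ> f) ` S. H m)"
    unfolding u H_def using sum.image_gen[OF S(1), of "\<lambda>a. lie_smult (r a) a" "length \<circ> f"] by simp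
  also have "\<dots> \<in> FL.span (right_normed ` {w. n \<le> length w})"
  proof (rule FL.span_sum)
    fix m assume "m \<in> (length \<circ> f) ` S"
    show "H m \<in> FL.span (right_normed ` {w. n \<le> length w})"
    proof (cases "m < n")
      case True
      then show ?thesis by (simp add: H0 FL.span_zero)
    next
      case False
      then show ?thesis
        unfolding H_def
      proof (intro FL.span_sum FL.span_scale FL.span_base)
        fix a assume "a \<in> {a \<in> S. length (f a) = m}"
        then show "a \<in> right_normed ` {w. n \<le> length w}"
          using f[of a] False by (intro image_eqI[of _ _ "f a"]) auto
      qed
    qed
  qed
  finally show ?thesis .
qed

text \<open>Brackets add word lengths, which gives one direction. Conversely,
  \<open>coef_vanish_span\<close> expands \<open>u\<close> in right-normed words of length at least
  \<open>n\<close>, and these are iterated brackets. At \<open>n = 1\<close> both sides hold for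
  every \<open>u\<close>, by \<open>coef_Nil\<close>.\<close>

theorem lower_central_iff_coef:
  fixes u :: "('k::field_char_0, 'x) free_lie"
  assumes fin: "finite (UNIV :: 'x set)"
  shows "u \<in> lower_central scalars free_lie_algebra n \<longleftrightarrow> (\<forall>w. length w < n \<longrightarrow> coef u w = 0)"
proof
  interpret F: lie_algebra scalars "free_lie_algebra :: ('k, ('k, 'x) free_lie) module"
    by (rule lie_algebra_free)
  let ?L = "lower_central scalars (free_lie_algebra :: ('k, ('k, 'x) free_lie) module)"
  have minus: "\<ominus>\<^bsub>free_lie_algebra\<^esub> x = - x" for x :: "('k, 'x) free_lie"
    by (rule F.L.M.minus_equality) simp_all
  show "\<forall>w. length w < n \<longrightarrow> coef u w = 0" if u: "u \<in> ?L n"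
  proof -
    have "?L n \<subseteq> {u. \<forall>w. length w < n \<longrightarrow> coef u w = 0}"
    proof (induction n)
      case (Suc m)
      show ?case
      proof (cases m)
        case (Suc m')
        have "bracket_span scalars free_lie_algebra UNIV (?L m) \<subseteq>
          {u. \<forall>w. length w < Suc m \<longrightarrow> coef u w = 0}"
        proof (rule bracket_span_subset)
          show "submodule {u. \<forall>w. length w < Suc m \<longrightarrow> coef u w = 0} scalars
            (free_lie_algebra :: ('k, ('k, 'x) free_lie) module)"
            by (rule F.L.submoduleI) (simp_all add: minus)
        qed (use Suc.IH in \<open>auto intro!: coef_bracket_vanish_Suc[of m]\<close>)
        then show ?thesis by (simp add: Suc)
      qed auto
    qed simp
    then show ?thesis using u by blast
  qed
  show "u \<in> ?L n" if u: "\<forall>w. length w < n \<longrightarrow> coef u w = 0"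
  proof -
    have mem: "right_normed w \<in> ?L n" if "n \<le> length w" for w n
      using that
    proof (induction w arbitrary: n)
      case (Cons x w)
      show ?case
      proof (cases "n \<le> 1")
        case True
        then show ?thesis by (cases n) auto
      next
        case False
        then obtain m where m: "n = Suc (Suc m)" by (metis One_nat_def bot_nat_0.extremum not0_implies_Suc not_less_eq_eq)
        have "w \<noteq> []" "right_normed w \<in> ?L (Suc m)"
          using Cons m by auto
        moreover have "lie_gen x \<otimes>\<^bsub>free_lie_algebra\<^esub> right_normed w
            \<in> bracket_span scalars free_lie_algebra (carrier free_lie_algebra) (?L (Suc m))"
          by (rule bracket_in_bracket_span) (simp, fact)
        ultimately show ?thesis
          by (simp only: m lower_central.simps right_normed_Cons[OF \<open>w \<noteq> []\<close>] free_lie_algebra_simps)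
      qed
    qed simp
    have sub: "submodule (?L n) scalars free_lie_algebra"
      by (rule conjunct1[OF F.lower_central_ideal])
    have "FL.subspace (?L n)"
      unfolding FL.subspace_def
      using F.L.submoduleE(4,5)[OF sub] submodule.axioms(1)[OF sub, THEN subgroup.one_closed]
      by simp
    then have "FL.span (right_normed ` {w. n \<le> length w}) \<subseteq> ?L n"
      using mem by (intro FL.span_minimal) auto
    then show ?thesis using coef_vanish_span[OF fin, where n = n and u = u] u by blast
  qed
qed


section \<open>Three letters and the quadratic system in degree two\<close>

lemma third_letter:
  fixes a b :: 'x
  assumes card: "CARD('x) = 3"
  shows "\<exists>d. d \<noteq> a \<and> d \<noteq> b"
proof (rule ccontr)
  assume "\<not> ?thesis"
  then have "(UNIV :: 'x set) \<subseteq> {a, b}" by auto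
  then have "CARD('x) \<le> card {a, b}" by (intro card_mono) auto
  also have "\<dots> \<le> 2" by (simp add: card_insert_if)
  finally show False using card by simp
qed


text \<open>\<open>\<Phi> x y\<close> is the degree-two part of $x\cdot y$; the assumption \<open>eq\<close> equates the two expressions for
  the degree-three part of $[x,y]\cdot z$. It is contracted twice: over the index \<open>z\<close> to kill the
  trace \<open>\<delta>\<close>, then over \<open>y\<close>.\<close>

lemma quadratic_system_trivial:
  fixes \<Phi> :: "'x \<Rightarrow> 'x \<Rightarrow> 'x \<Rightarrow> 'x \<Rightarrow> 'k::field_char_0"
  assumes card: "CARD('x) = 3"
    and comm: "\<And>x y k l. \<Phi> x y k l = \<Phi> y x k l"
    and anti: "\<And>x y k l. \<Phi> x y k l = - \<Phi> x y l k"
    and eq: "\<And>x y z l m n.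
      (if y = n then \<Phi> z x l m else 0) - (if y = l then \<Phi> z x m n else 0)
      + (if x = l then \<Phi> z y m n else 0) - (if x = n then \<Phi> z y l m else 0) =
      (\<Sum>k\<in>UNIV. \<Phi> y z k n * \<Phi> x k l m) + (\<Sum>k\<in>UNIV. \<Phi> y z l k * \<Phi> x k m n)
      - (\<Sum>k\<in>UNIV. \<Phi> x z k n * \<Phi> y k l m) - (\<Sum>k\<in>UNIV. \<Phi> x z l k * \<Phi> y k m n)"
  shows "\<Phi> x y k l = 0"
proof -
  have fin: "finite (UNIV :: 'x set)"
    using card by (metis card.infinite zero_neq_numeral)
  \<comment> \<open>\<open>\<delta>\<close> is the trace of the tensor over its first and last
    index; \<open>G\<close> is the quadratic term that remains once this trace is zero.\<close>
  define \<delta> where "\<delta> x m = (\<Sum>z\<in>UNIV. \<Phi> z x m z)" for x m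
  define G where "G x y l m = (\<Sum>z\<in>UNIV. \<Sum>k\<in>UNIV. \<Phi> x z l k * \<Phi> y k m z)" for x y l m
  have G_swap: "G x y l m = G y x m l" for x y l m
    unfolding G_def by (subst sum.swap) (simp add: mult.commute)
  have sum_if: "(\<Sum>z\<in>UNIV. if b then f z else 0) = (if b then sum f UNIV else 0)"
    for b and f :: "'x \<Rightarrow> 'k"
    by simp
  have prod_\<delta>: "(\<Sum>z\<in>UNIV. \<Sum>k\<in>UNIV. \<Phi> y z k z * f k) = (\<Sum>k\<in>UNIV. \<delta> y k * f k)" for y f
    by (subst sum.swap) (simp add: \<delta>_def sum_distrib_right comm[of y])
  \<comment> \<open>The equation \<open>eq\<close> with \<open>n\<close> set to \<open>z\<close>,
    summed over \<open>z\<close>.\<close>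
  have c1: "(if x = l then \<delta> y m else 0) - (if y = l then \<delta> x m else 0) =
      (\<Sum>k\<in>UNIV. \<delta> y k * \<Phi> x k l m) - (\<Sum>k\<in>UNIV. \<delta> x k * \<Phi> y k l m) + G y x l m - G x y l m"
    for x y l m
  proof -
    have "(\<Sum>z\<in>UNIV. (if y = z then \<Phi> z x l m else 0) - (if y = l then \<Phi> z x m z else 0)
        + (if x = l then \<Phi> z y m z else 0) - (if x = z then \<Phi> z y l m else 0)) =
      (\<Sum>z\<in>UNIV. (\<Sum>k\<in>UNIV. \<Phi> y z k z * \<Phi> x k l m) + (\<Sum>k\<in>UNIV. \<Phi> y z l k * \<Phi> x k m z)
        - (\<Sum>k\<in>UNIV. \<Phi> x z k z * \<Phi> y k l m) - (\<Sum>k\<in>UNIV. \<Phi> x z l k * \<Phi> y k m z))"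
      by (rule sum.cong[OF HOL.refl]) (rule eq)
    then show ?thesis
      by (simp add: sum.distrib sum_subtractf prod_\<delta> G_def[symmetric] fin \<delta>_def[symmetric]
          comm[of y x] sum_if cong: if_cong)
  qed
  \<comment> \<open>Symmetrising \<open>c1\<close> in \<open>l\<close> and \<open>m\<close> removes
    its right-hand side: \<open>\<Phi>\<close> is antisymmetric in these indices, and the
    \<open>G\<close> terms cancel by \<open>G_swap\<close>.\<close>
  have c2: "(if x = l then \<delta> y m else 0) - (if y = l then \<delta> x m else 0)
      + (if x = m then \<delta> y l else 0) - (if y = m then \<delta> x l else 0) = 0" for x y l m
  proof -
    have neg: "(\<Sum>k\<in>UNIV. \<delta> y k * \<Phi> x k m l) = - (\<Sum>k\<in>UNIV. \<delta> y k * \<Phi> x k l m)" for x y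
      by (simp add: anti[of x _ m l] sum_negf)
    have "((if x = l then \<delta> y m else 0) - (if y = l then \<delta> x m else 0))
      + ((if x = m then \<delta> y l else 0) - (if y = m then \<delta> x l else 0)) = 0"
      unfolding c1 neg[of y x] neg[of x y] G_swap[of y x m l] G_swap[of x y m l] by simp
    then show ?thesis by (simp only: add_diff_eq)
  qed
  have \<delta>_off: "\<delta> y x = 0" if "x \<noteq> y" for x y
    using c2[of x x y x] that by simp
  have \<delta>_diag: "\<delta> y y = \<delta> x x" for x y
    using c2[of x x y y] by (cases "x = y") auto
  \<comment> \<open>The matrix \<open>\<delta>\<close> is now known to be scalar. Exchanging the two
    summation indices changes the sign of its trace, so the trace and with it the scalar
    vanish.\<close>
  have "(\<Sum>x\<in>UNIV. \<delta> x x) = (\<Sum>x\<in>UNIV. \<Sum>z\<in>UNIV. \<Phi> x z z x)"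
    unfolding \<delta>_def by (rule sum.swap)
  also have "\<dots> = (\<Sum>x\<in>UNIV. \<Sum>z\<in>UNIV. - \<Phi> z x x z)"
    by (intro sum.cong HOL.refl) (metis comm anti)
  also have "\<dots> = - (\<Sum>x\<in>UNIV. \<delta> x x)"
    by (simp add: \<delta>_def sum_negf)
  finally have "(\<Sum>x\<in>UNIV. \<delta> x x) = 0" by simp
  moreover have "(\<Sum>x\<in>UNIV. \<delta> x x) = 3 * \<delta> y y" for y
  proof -
    have "(\<Sum>x\<in>UNIV. \<delta> x x) = (\<Sum>x\<in>(UNIV :: 'x set). \<delta> y y)"
      by (rule sum.cong[OF HOL.refl]) (rule \<delta>_diag)
    then show ?thesis by (simp add: card)
  qed
  ultimately have \<delta>0: "\<delta> x y = 0" for x y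
    using \<delta>_off by (cases "x = y") auto
  have \<delta>1: "(\<Sum>z\<in>UNIV. \<Phi> z x m z) = 0" "(\<Sum>z\<in>UNIV. \<Phi> x z m z) = 0" for x m
    using \<delta>0[of x m] comm[of x] by (simp_all add: \<delta>_def)
  \<comment> \<open>The equation \<open>eq\<close> with \<open>n\<close> set to \<open>y\<close>,
    summed over \<open>y\<close>. On the left the first term gives 3, the number of letters, the
    second gives 1 by antisymmetry, and the fourth gives -1.\<close>
  have c3: "3 * \<Phi> z x l m = G z x l m" for z x l m
  proof -
    have "(\<Sum>y\<in>UNIV. (if y = y then \<Phi> z x l m else 0) - (if y = l then \<Phi> z x m y else 0)
        + (if x = l then \<Phi> z y m y else 0) - (if x = y then \<Phi> z y l m else 0)) =
      (\<Sum>y\<in>UNIV. (\<Sum>k\<in>UNIV. \<Phi> y z k y * \<Phi> x k l m) + (\<Sum>k\<in>UNIV. \<Phi> y z l k * \<Phi> x k m y)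
        - (\<Sum>k\<in>UNIV. \<Phi> x z k y * \<Phi> y k l m) - (\<Sum>k\<in>UNIV. \<Phi> x z l k * \<Phi> y k m y))"
      by (rule sum.cong[OF HOL.refl]) (rule eq)
    moreover have "(\<Sum>y\<in>UNIV. \<Sum>k\<in>UNIV. \<Phi> y z k y * \<Phi> x k l m) = 0"
      by (subst sum.swap) (simp add: sum_distrib_right[symmetric] \<delta>1)
    moreover have "(\<Sum>y\<in>UNIV. \<Sum>k\<in>UNIV. \<Phi> x z l k * \<Phi> y k m y) = 0"
      by (subst sum.swap) (simp add: sum_distrib_left[symmetric] \<delta>1)
    moreover have "(\<Sum>y\<in>UNIV. \<Sum>k\<in>UNIV. \<Phi> x z k y * \<Phi> y k l m) = 0" (is "?S = 0")
    proof -
      have "?S = (\<Sum>y\<in>UNIV. \<Sum>k\<in>UNIV. \<Phi> x z y k * \<Phi> k y l m)"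
        by (rule sum.swap)
      also have "\<dots> = (\<Sum>y\<in>UNIV. \<Sum>k\<in>UNIV. - (\<Phi> x z k y * \<Phi> y k l m))"
        by (intro sum.cong HOL.refl) (metis comm anti minus_mult_left)
      finally show ?thesis by (simp add: sum_negf)
    qed
    moreover have "(\<Sum>y\<in>UNIV. \<Sum>k\<in>UNIV. \<Phi> y z l k * \<Phi> x k m y) = G z x l m"
      by (simp add: G_def comm[of _ z])
    ultimately show ?thesis
      using anti[of z x m l]
      by (simp add: sum.distrib sum_subtractf fin \<delta>1 card sum_if cong: if_cong)
  qed
  \<comment> \<open>By \<open>c3\<close> and \<open>G_swap\<close> the tensor is symmetric in its
    last two indices, in which it is also antisymmetric.\<close>
  have "3 * \<Phi> x y k l = 3 * \<Phi> x y l k"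
    using c3[of x y k l] c3[of y x l k] G_swap[of x y k l] comm[of x y] by simp
  then show ?thesis using anti[of x y k l] by simp
qed


section \<open>Products on the free Lie algebra modulo long words\<close>

definition nil_class :: "nat \<Rightarrow> ('k::field, 'x) free_lie \<Rightarrow> ('k, 'x) free_lie set" where
  "nil_class c u = lower_central scalars free_lie_algebra (Suc c) +>\<^bsub>free_lie_algebra\<^esub> u"

text \<open>Through \<open>lower_central_iff_coef\<close>, equations in the quotient become
  equations between coefficients of words of length at most \<open>c\<close>.\<close>

lemma nil_class_eq_iff:
  fixes u :: "('k::field_char_0, 'x) free_lie"
  assumes fin: "finite (UNIV :: 'x set)"
  shows "nil_class c u = nil_class c v \<longleftrightarrow> (\<forall>w. length w \<le> c \<longrightarrow> coef u w = coef v w)"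
proof -
  have mem: "x \<in> nil_class c y \<longleftrightarrow> (\<forall>w. length w \<le> c \<longrightarrow> coef x w = coef y w)"
    for x y :: "('k, 'x) free_lie"
  proof -
    have "x \<in> nil_class c y \<longleftrightarrow> (\<exists>i\<in>lower_central scalars free_lie_algebra (Suc c). x = i + y)"
      by (simp add: nil_class_def a_r_coset_def')
    also have "\<dots> \<longleftrightarrow> x - y \<in> lower_central scalars free_lie_algebra (Suc c)"
      by (metis add_diff_cancel diff_add_cancel)
    finally show ?thesis by (simp add: lower_central_iff_coef[OF fin] less_Suc_eq_le)
  qed
  show ?thesis
  proof
    assume "nil_class c u = nil_class c v"
    then have "u \<in> nil_class c v" using mem[of u u] by simp
    then show "\<forall>w. length w \<le> c \<longrightarrow> coef u w = coef v w" by (simp add: mem)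
  qed (auto simp: mem)
qed

lemma free_nilpotent_nil_class:
  fixes u v :: "('k::field_char_0, 'x) free_lie"
  assumes fin: "finite (UNIV :: 'x set)"
  shows "carrier (free_nilpotent c) = range (nil_class c :: ('k, 'x) free_lie \<Rightarrow> _)"
    and "\<zero>\<^bsub>free_nilpotent c\<^esub> = nil_class c (0 :: ('k, 'x) free_lie)"
    and "nil_class c u \<oplus>\<^bsub>free_nilpotent c\<^esub> nil_class c v = nil_class c (u + v)"
    and "k \<odot>\<^bsub>free_nilpotent c\<^esub> nil_class c u = nil_class c (lie_smult k u)"
    and "nil_class c u \<otimes>\<^bsub>free_nilpotent c\<^esub> nil_class c v = nil_class c (lie_bracket u v)"
proof -
  let ?F = "free_lie_algebra :: ('k, ('k, 'x) free_lie) module"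
  let ?I = "lower_central scalars ?F (Suc c)"
  interpret F: lie_algebra scalars ?F by (rule lie_algebra_free)
  interpret I: submodule ?I scalars ?F by (rule conjunct1[OF F.lower_central_ideal])
  interpret A: abelian_subgroup ?I ?F
    by (intro abelian_subgroupI3 additive_subgroup.intro I.subgroup_axioms
        F.L.M.abelian_group_axioms)
  have self: "x \<in> nil_class c x" for x :: "('k, 'x) free_lie"
    unfolding nil_class_def by (rule A.a_rcos_self) simp
  have coefD: "coef x w = coef y w" if "x \<in> nil_class c y" "length w \<le> c" for x y :: "('k, 'x) free_lie" and w
    using that by (auto simp: nil_class_def a_r_coset_def' lower_central_iff_coef[OF fin])
  show "carrier (free_nilpotent c) = range (nil_class c :: ('k, 'x) free_lie \<Rightarrow> _)"
    by (auto simp: free_nilpotent_def nil_class_def lie_quotient_def FactRing_def A_RCOSETS_def'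
        a_r_coset_def')
  show "\<zero>\<^bsub>free_nilpotent c\<^esub> = nil_class c (0 :: ('k, 'x) free_lie)"
    using F.L.M.a_coset_add_zero[OF A.a_subset]
    by (simp add: free_nilpotent_def nil_class_def lie_quotient_def FactRing_def)
  show "nil_class c u \<oplus>\<^bsub>free_nilpotent c\<^esub> nil_class c v = nil_class c (u + v)"
    using A.a_rcos_sum[of u v]
    by (simp add: free_nilpotent_def nil_class_def lie_quotient_def FactRing_def)
  \<comment> \<open>Scalar multiplication and bracket of the quotient are unions of cosets over all
    representatives, so each union is shown to have constant terms.\<close>
  have "(\<Union>x\<in>nil_class c u. nil_class c (lie_smult k x)) =
      (\<Union>x\<in>nil_class c u. nil_class c (lie_smult k u))"
    by (rule SUP_cong[OF HOL.refl]) (simp add: nil_class_eq_iff[OF fin] coefD)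
  also have "\<dots> = nil_class c (lie_smult k u)"
    using self by blast
  finally show "k \<odot>\<^bsub>free_nilpotent c\<^esub> nil_class c u = nil_class c (lie_smult k u)"
    by (simp add: free_nilpotent_def nil_class_def lie_quotient_def)
  have br: "nil_class c (lie_bracket x y) = nil_class c (lie_bracket u v)"
    if "x \<in> nil_class c u" "y \<in> nil_class c v" for x y
  proof -
    have "lie_bracket x y - lie_bracket u v = lie_bracket x (y - v) - lie_bracket v (x - u)"
      using bracket_anti[of x v] bracket_anti[of u v]
      by (simp add: bracket_diff_r)
    moreover have "coef (lie_bracket x (y - v)) w = 0" "coef (lie_bracket v (x - u)) w = 0"
      if "length w \<le> c" for w
      by (rule coef_bracket_vanish_Suc[of c];
          use that coefD \<open>x \<in> nil_class c u\<close> \<open>y \<in> nil_class c v\<close> in simp)+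
    ultimately have "coef (lie_bracket x y - lie_bracket u v) w = 0" if "length w \<le> c" for w
      using that by simp
    then show ?thesis by (simp add: nil_class_eq_iff[OF fin])
  qed
  have "(\<Union>x\<in>nil_class c u. \<Union>y\<in>nil_class c v. nil_class c (lie_bracket x y)) =
      (\<Union>x\<in>nil_class c u. \<Union>y\<in>nil_class c v. nil_class c (lie_bracket u v))"
    by (rule SUP_cong[OF HOL.refl], rule SUP_cong[OF HOL.refl]) (rule br)
  also have "\<dots> = nil_class c (lie_bracket u v)"
    using self by blast
  finally show "nil_class c u \<otimes>\<^bsub>free_nilpotent c\<^esub> nil_class c v = nil_class c (lie_bracket u v)"
    by (simp add: free_nilpotent_def nil_class_def lie_quotient_def FactRing_def rcoset_mult_def)
qed

text \<open>A CPA-structure on the quotient, lifted to representatives in the free Lie algebra. The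
  lift is arbitrary beyond length \<open>c\<close>, so each identity is only required for words up
  to that length.\<close>

locale free_lie_product =
  fixes c :: nat
    and p :: "('k::field_char_0, 'x) free_lie \<Rightarrow> ('k, 'x) free_lie \<Rightarrow> ('k, 'x) free_lie"
  assumes fin: "finite (UNIV :: 'x set)"
    and prod_add: "length w \<le> c \<Longrightarrow> coef (p u (v + z)) w = coef (p u v) w + coef (p u z) w"
    and prod_smult: "length w \<le> c \<Longrightarrow> coef (p u (lie_smult k v)) w = k * coef (p u v) w"
    and prod_commute: "length w \<le> c \<Longrightarrow> coef (p u v) w = coef (p v u) w"
    and bracket_prod: "length w \<le> c \<Longrightarrow>
      coef (p (lie_bracket u v) z) w = coef (p u (p v z)) w - coef (p v (p u z)) w"
    and prod_bracket: "length w \<le> c \<Longrightarrow>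
      coef (p u (lie_bracket v z)) w =
        coef (lie_bracket (p u v) z) w + coef (lie_bracket v (p u z)) w"
begin

lemma prod_zero: "length w \<le> c \<Longrightarrow> coef (p u 0) w = 0"
  using prod_add[of w u 0 0] by simp

lemma bracket_prod': "length w \<le> c \<Longrightarrow>
  coef (p (lie_bracket u v) z) w = coef (lie_bracket (p z u) v) w + coef (lie_bracket u (p z v)) w"
  using prod_commute[of w "lie_bracket u v" z] prod_bracket[of w z u v] by simp

text \<open>Membership of the class of \<open>u\<close> in the \<open>n\<close>-th term of the lower central series of $F/F^{c+1}$.\<close>

definition depth :: "nat \<Rightarrow> ('k, 'x) free_lie \<Rightarrow> bool" where
  "depth n u \<longleftrightarrow> (\<forall>w. length w < n \<longrightarrow> length w \<le> c \<longrightarrow> coef u w = 0)"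

lemma depthD: "depth n u \<Longrightarrow> length w < n \<Longrightarrow> length w \<le> c \<Longrightarrow> coef u w = 0"
  by (simp add: depth_def)

lemma depth_bracket:
  assumes "depth m u" "depth n v"
  shows "depth (m + n) (lie_bracket u v)"
  unfolding depth_def
proof (intro allI impI)
  fix w :: "'x list" assume "length w < m + n" "length w \<le> c"
  \<comment> \<open>The bound is capped at \<open>Suc c\<close> because \<open>depth\<close> says
    nothing about longer words; the lower bound 1 comes from \<open>coef_Nil\<close>.\<close>
  moreover have "coef z v = 0" if "depth k z" "length v < max 1 (min k (Suc c))" for k z v
    using that by (cases "v = []") (auto simp: depth_def less_Suc_eq_le max_def split: if_splits)
  ultimately show "coef (lie_bracket u v) w = 0"
    using assms
    by (intro coef_bracket_vanish[of "max 1 (min m (Suc c))" _ "max 1 (min n (Suc c))"]) auto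
qed

lemma depth_1: "depth (Suc 0) u"
  by (simp add: depth_def)

lemma depth_right_normed: "depth (length w) (right_normed w)"
  by (simp add: depth_def coef_right_normed)

lemma depth_prod_span:
  assumes "\<And>y. y \<in> S \<Longrightarrow> depth m (p u y)" "v \<in> FL.span S"
  shows "depth m (p u v)"
  using assms(2)
proof (induction rule: FL.span_induct_alt)
  case base
  then show ?case by (simp add: depth_def prod_zero)
next
  case (step k y z)
  then show ?case using assms(1) by (simp add: depth_def prod_add prod_smult)
qed

text \<open>Multiplication by \<open>u\<close> is a derivation: if it raises the depth of every
  generator by \<open>d\<close>, it does so for iterated brackets.\<close>

lemma depth_prod_right_normed:
  assumes "\<And>x. depth (Suc d) (p u (lie_gen x))"
  shows "depth (length w + d) (p u (right_normed w))"
proof (induction w rule: right_normed.induct)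
  case 1
  then show ?case by (simp add: depth_def prod_zero)
next
  case (2 x)
  then show ?case using assms by simp
next
  case (3 x y w)
  have "depth (Suc d + length (y # w)) (lie_bracket (p u (lie_gen x)) (right_normed (y # w)))"
    by (intro depth_bracket assms depth_right_normed)
  moreover have "depth (Suc 0 + (length (y # w) + d))
      (lie_bracket (lie_gen x) (p u (right_normed (y # w))))"
    by (intro depth_bracket depth_1 3)
  ultimately show ?case by (simp add: depth_def prod_bracket)
qed

text \<open>The derivation argument is used twice: first for multiplication by a generator, then,
  after commuting the factors, for multiplication by any \<open>u\<close>.\<close>

lemma depth_prod:
  assumes gen: "\<And>x y. depth (Suc d) (p (lie_gen x) (lie_gen y))" and v: "depth n v"
  shows "depth (n + d) (p u v)"
proof -
  have 1: "depth (Suc d) (p (lie_gen x) u)" for x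
  proof (rule depth_prod_span[OF _ span_right_normed])
    fix y :: "('k, 'x) free_lie" assume "y \<in> range right_normed"
    then obtain w where w: "y = right_normed w" by blast
    show "depth (Suc d) (p (lie_gen x) y)"
      using depth_prod_right_normed[of d "lie_gen x" w] gen
      by (cases w) (auto simp: w depth_def prod_zero)
  qed
  then have "depth (Suc d) (p u (lie_gen x))" for x
    by (simp add: depth_def prod_commute[of _ u])
  then have 2: "depth (length w + d) (p u (right_normed w))" for w
    by (rule depth_prod_right_normed)
  have "v \<in> FL.span (right_normed ` {w. min n (Suc c) \<le> length w})"
    using v by (intro coef_vanish_span[OF fin]) (simp add: depth_def)
  then have "depth (min n (Suc c) + d) (p u v)"
  proof (rule depth_prod_span[rotated])
    fix y :: "('k, 'x) free_lie" assume "y \<in> right_normed ` {w. min n (Suc c) \<le> length w}"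
    then show "depth (min n (Suc c) + d) (p u y)"
      using 2 unfolding depth_def by fastforce
  qed
  then show ?thesis by (auto simp: depth_def)
qed

section \<open>Vanishing of the products of generators, degree by degree\<close>

lemma degree_one_zero:
  assumes c: "3 \<le> c" and card: "CARD('x) = 3"
  shows "coef (p (lie_gen i) (lie_gen j)) [k] = 0"
proof -
  define A where "A i j k = coef (p (lie_gen i) (lie_gen j)) [k]" for i j k
  have comm: "A i j k = A j i k" for i j k
    unfolding A_def by (rule prod_commute) (use c in simp)
  \<comment> \<open>For all distinct \<open>a\<close>, \<open>b\<close>, \<open>d\<close> together
    this says that \<open>a\<close> acts on the generators as a scalar matrix in degree one.\<close>
  have rel: "A a a a = A a d d \<and> A a a b = 0 \<and> A a b a = 0 \<and> A a b d = 0"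
    if "a \<noteq> b" "a \<noteq> d" "b \<noteq> d" for a b d
  proof -
    let ?a = "lie_gen a" and ?b = "lie_gen b" and ?d = "lie_gen d"
    have 1: "coef (p (lie_bracket u v) z) [i] = 0" for u v z i
      using c by (simp add: bracket_prod')
    have 2: "coef (p (lie_bracket (lie_gen x) (lie_gen y)) (lie_gen z)) [i, j] =
      A z x i * coef (lie_gen y) [j] - coef (lie_gen y) [i] * A z x j
      + (coef (lie_gen x) [i] * A z y j - A z y i * coef (lie_gen x) [j])" for x y z i j
      using c by (simp add: bracket_prod' coef_bracket2 A_def)
    text \<open>Both sides compute the same coefficient of $[a,b]\cdot[a,d]$, expanding by the derivation
      rule the second and the first factor; the difference is
      $[a\cdot a,[b,d]]+[a\cdot b,[d,a]]+[a\cdot d,[a,b]]$.\<close>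
    have main: "coef (lie_bracket (p (lie_bracket ?a ?b) ?a) ?d) w
        + coef (lie_bracket ?a (p (lie_bracket ?a ?b) ?d)) w =
      coef (lie_bracket (p (lie_bracket ?a ?d) ?a) ?b) w
        + coef (lie_bracket ?a (p (lie_bracket ?a ?d) ?b)) w" if "length w \<le> c" for w
      using prod_bracket[OF that, of "lie_bracket ?a ?b" ?a ?d]
        bracket_prod'[OF that, of ?a ?b "lie_bracket ?a ?d"] by simp
    note expand = coef_bracket3 1 2 coef_gen comm[of b a] comm[of d a] comm[of d b]
    have "A a a a = A a d d" using main[of "[a, b, d]"] c that by (simp add: expand)
    moreover have "A a a b = 0" using main[of "[b, b, d]"] c that by (simp add: expand)
    moreover have "A a b a = 0" using main[of "[a, a, d]"] c that by (simp add: expand)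
    moreover have "A a b d = 0" using main[of "[d, d, a]"] c that by (simp add: expand)
    ultimately show ?thesis by blast
  qed
  note third = third_letter[OF card]
  \<comment> \<open>By commutativity the diagonal entry \<open>A a b b\<close> is the off-diagonal
    entry \<open>A b a b\<close> of the matrix of \<open>b\<close>.\<close>
  have A0: "A a b k = 0" if "a \<noteq> b" for a b k
  proof -
    obtain d where d: "d \<noteq> a" "d \<noteq> b" using third by blast
    have "(UNIV :: 'x set) = {a, b, d}"
      by (rule card_subset_eq[OF fin, symmetric]) (use that d card in auto)
    then have "k = a \<or> k = b \<or> k = d" by blast
    then show ?thesis
      using rel[of a b d] rel[of b a d] comm[of a b] that d by auto
  qed
  \<comment> \<open>The remaining diagonal entry \<open>A a a a\<close> equals
    \<open>A a d d\<close>, which \<open>A0\<close> covers.\<close>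
  have "A a a k = 0" for a k
  proof -
    obtain b d where bd: "b \<noteq> a" "d \<noteq> a" "d \<noteq> b" using third by metis
    show ?thesis
    proof (cases "k = a")
      case True
      then show ?thesis using rel[of a b d] A0[of a d] bd by simp
    next
      case False
      obtain e where "e \<noteq> a" "e \<noteq> k" using third by blast
      then show ?thesis using rel[of a k e] False by auto
    qed
  qed
  then show ?thesis using A0 A_def by (cases "i = j") auto
qed

text \<open>Here the leading degree of the products is \<open>Suc d\<close>, so that
  \<open>d\<close> is the amount by which multiplication raises depth.\<close>

lemma depth_raise:
  assumes d: "2 \<le> d" "Suc d < c" and card: "CARD('x) = 3"
    and gen: "\<And>x y. depth (Suc d) (p (lie_gen x) (lie_gen y))"
  shows "depth (Suc (Suc d)) (p (lie_gen x) (lie_gen y))"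
proof -
  have eq: "coef (lie_bracket (lie_gen z) (p (lie_gen x) (lie_gen y))) w =
      coef (lie_bracket (lie_gen y) (p (lie_gen x) (lie_gen z))) w"
    if w: "length w = Suc (Suc d)" for y z w
  proof -
    let ?x = "lie_gen x" and ?y = "lie_gen y" and ?z = "lie_gen z"
    have c: "length w \<le> c" using w d by simp
    \<comment> \<open>These double products have depth \<open>2 * d + 1\<close>, which exceeds
      \<open>length w = d + 2\<close> because \<open>d\<close> is at least 2.\<close>
    have 0: "coef (p (lie_gen s) (p (lie_gen t) ?x)) w = 0" for s t
      using depth_prod[OF gen gen, of "lie_gen s" t x] by (rule depthD) (use w d in auto)
    have "coef (p ?x (lie_bracket ?y ?z)) w = 0"
      by (simp add: prod_commute[OF c, of ?x] bracket_prod[OF c] 0)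
    then show ?thesis
      using prod_bracket[OF c, of ?x ?y ?z] bracket_anti[of "p ?x ?y" ?z] by simp
  qed
  have outside: "coef (p (lie_gen x) (lie_gen y)) u = 0"
    if yz: "y \<noteq> z" and u: "length u = Suc d" and l: "l \<in> set u" "l \<noteq> y" "l \<noteq> z" for y z l u
  proof -
    let ?P = "coef (p (lie_gen x) (lie_gen y))" and ?Q = "coef (p (lie_gen x) (lie_gen z))"
    text \<open>The coefficients of $(x\cdot y)z-(x\cdot z)y$ are invariant under cyclic rotation, but vanish
      on words that do not end in \<open>y\<close> or \<open>z\<close>.\<close>
    define t where "t w = (if last w = z then ?P (butlast w) else 0)
      - (if last w = y then ?Q (butlast w) else 0)" for w
    have rot1: "t (rotate1 w) = t w" if len: "length w = Suc (Suc d)" for w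
    proof -
      obtain r v where "w = r # v" using len by (cases w) auto
      then show ?thesis
        using eq[OF len, of z y] len
        by (simp add: t_def coef_bracket_gen algebra_simps split: if_splits)
    qed
    have rot: "t (rotate n w) = t w" if "length w = Suc (Suc d)" for n w
      using that by (induction n) (simp_all add: rot1)
    obtain a b where ab: "u = a @ l # b" using l by (metis split_list)
    \<comment> \<open>The word \<open>u @ [z]\<close> is rotated until \<open>l\<close>, which is
      neither \<open>y\<close> nor \<open>z\<close>, stands last.\<close>
    have "rotate (length (a @ [l])) ((a @ [l]) @ b @ [z]) = (b @ [z]) @ a @ [l]"
      by (rule rotate_append)
    then have "t (u @ [z]) = t ((b @ [z]) @ a @ [l])"
      using rot[of "u @ [z]" "length (a @ [l])"] u by (simp add: ab)
    also have "\<dots> = 0" using l by (simp add: t_def)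
    finally show ?thesis using yz by (simp add: t_def)
  qed
  show ?thesis
    unfolding depth_def
  proof (intro allI impI)
    fix u :: "'x list" assume u: "length u < Suc (Suc d)" "length u \<le> c"
    show "coef (p (lie_gen x) (lie_gen y)) u = 0"
    proof (cases "length u = Suc d")
      case False
      then show ?thesis using depthD[OF gen, of u] u by simp
    next
      case len: True
      show ?thesis
      proof (cases "\<exists>l\<in>set u. l \<noteq> y")
        case True
        then obtain l where l: "l \<in> set u" "l \<noteq> y" by blast
        \<comment> \<open>With three letters there is a \<open>z\<close> avoiding both
          \<open>y\<close> and the given letter \<open>l\<close>, as \<open>outside\<close>
          requires.\<close>
        obtain z where "z \<noteq> y" "z \<noteq> l"
          using third_letter[OF card] by blast
        then show ?thesis using outside[of y z u l] l len by auto
      next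
        case False
        then have "u = replicate (length u) y"
          by (metis replicate_length_same)
        then show ?thesis using coef_replicate[of "length u"] len d by (metis Suc_le_mono le_SucI numeral_2_eq_2)
      qed
    qed
  qed
qed

lemma coef_prod_length3:
  assumes c: "3 \<le> c" and gen: "\<And>x y. depth 2 (p (lie_gen x) (lie_gen y))" and v: "depth 2 v"
  shows "coef (p (lie_gen x) v) [l, m, n] =
    (\<Sum>k\<in>UNIV. coef v [k, n] * coef (p (lie_gen x) (lie_gen k)) [l, m])
    + (\<Sum>k\<in>UNIV. coef v [l, k] * coef (p (lie_gen x) (lie_gen k)) [m, n])"
proof -
  let ?P = "\<lambda>k. coef (p (lie_gen x) (lie_gen k))"
  have "v \<in> FL.span (right_normed ` {w. 2 \<le> length w})"
    using v c by (intro coef_vanish_span[OF fin]) (simp add: depth_def)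
  then show ?thesis
  proof (induction rule: FL.span_induct_alt)
    case base
    then show ?case using c by (simp add: prod_zero)
  next
    case (step r y z)
    then obtain w where w: "y = right_normed w" "2 \<le> length w" by auto
    have "coef (p (lie_gen x) y) [l, m, n] =
      (\<Sum>k\<in>UNIV. coef y [k, n] * ?P k [l, m]) + (\<Sum>k\<in>UNIV. coef y [l, k] * ?P k [m, n])"
    proof (cases "length w = 2")
      case True
      then obtain i j where "w = [i, j]" by (auto simp: numeral_2_eq_2 length_Suc_conv)
      moreover have "?P k [t] = 0" for k t
        using depthD[OF gen, of "[t]"] c by simp
      ultimately show ?thesis
        using c by (simp add: w prod_bracket coef_bracket3 coef_bracket2 coef_gen left_diff_distrib
            sum_subtractf fin if_distrib[of "\<lambda>a. a * _"] cong: if_cong)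
    next
      case False
      then have "3 \<le> length w" using w by simp
      moreover have "depth (length w + 1) (p (lie_gen x) y)"
        unfolding w(1) using gen by (intro depth_prod depth_right_normed) (simp add: numeral_2_eq_2)
      ultimately have "coef (p (lie_gen x) y) [l, m, n] = 0"
        using c by (intro depthD) auto
      moreover have "coef y [s, t] = 0" for s t
        unfolding w(1) using False by (intro coef_right_normed) simp
      ultimately show ?thesis by simp
    qed
    then show ?case
      using step(2) c
      by (simp add: prod_add prod_smult algebra_simps sum.distrib sum_distrib_left)
  qed
qed

text \<open>The degree-two part of a Lie element is a combination of commutators of letters.\<close>

lemma coef_swap2: "coef u [i, j] = - coef u [j, i]"
  using span_right_normed[of u]
proof (induction rule: FL.span_induct_alt)
  case (step k y z)
  then obtain w where w: "y = right_normed w" by auto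
  have "coef y [i, j] = - coef y [j, i]"
    unfolding w by (cases w rule: right_normed.cases) (simp_all add: coef_gen coef_bracket2)
  then show ?case using step by simp
qed simp

lemma degree_two_zero:
  assumes c: "3 \<le> c" and card: "CARD('x) = 3"
    and gen: "\<And>x y. depth 2 (p (lie_gen x) (lie_gen y))"
  shows "coef (p (lie_gen x) (lie_gen y)) [k, l] = 0"
proof (rule quadratic_system_trivial[OF card, where \<Phi> = "\<lambda>x y k l. coef (p (lie_gen x) (lie_gen y)) [k, l]"])
  fix x y z l m n :: 'x
  let ?P = "\<lambda>x y. coef (p (lie_gen x) (lie_gen y))"
  have 0: "?P s t [i] = 0" for s t i
    using depthD[OF gen, of "[i]"] c by simp
  \<comment> \<open>First evaluation: commute the factors and apply the derivation rule. This is the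
    linear side of the system.\<close>
  have "coef (p (lie_bracket (lie_gen x) (lie_gen y)) (lie_gen z)) [l, m, n] =
    (if y = n then ?P z x [l, m] else 0) - (if y = l then ?P z x [m, n] else 0)
    + (if x = l then ?P z y [m, n] else 0) - (if x = n then ?P z y [l, m] else 0)"
    using c by (simp add: bracket_prod' coef_bracket3 coef_gen 0)
  moreover have "coef (p (lie_bracket (lie_gen x) (lie_gen y)) (lie_gen z)) [l, m, n] =
    (\<Sum>k\<in>UNIV. ?P y z [k, n] * ?P x k [l, m]) + (\<Sum>k\<in>UNIV. ?P y z [l, k] * ?P x k [m, n])
    - (\<Sum>k\<in>UNIV. ?P x z [k, n] * ?P y k [l, m]) - (\<Sum>k\<in>UNIV. ?P x z [l, k] * ?P y k [m, n])"
    using c by (simp add: bracket_prod coef_prod_length3[OF c gen gen])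
  ultimately show "(if y = n then ?P z x [l, m] else 0) - (if y = l then ?P z x [m, n] else 0)
    + (if x = l then ?P z y [m, n] else 0) - (if x = n then ?P z y [l, m] else 0) =
    (\<Sum>k\<in>UNIV. ?P y z [k, n] * ?P x k [l, m]) + (\<Sum>k\<in>UNIV. ?P y z [l, k] * ?P x k [m, n])
    - (\<Sum>k\<in>UNIV. ?P x z [k, n] * ?P y k [l, m]) - (\<Sum>k\<in>UNIV. ?P x z [l, k] * ?P y k [m, n])"
    by simp
next
  fix x y k l :: 'x
  show "coef (p (lie_gen x) (lie_gen y)) [k, l] = coef (p (lie_gen y) (lie_gen x)) [k, l]"
    by (rule prod_commute) (use c in simp)
  show "coef (p (lie_gen x) (lie_gen y)) [k, l] = - coef (p (lie_gen x) (lie_gen y)) [l, k]"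
    by (rule coef_swap2)
qed

text \<open>The products of generators are raised to depth \<open>c\<close> step by step;
  \<open>depth_prod\<close>, applied to a factor of depth 1, then extends this to all
  products.\<close>

lemma prod_depth:
  assumes c: "3 \<le> c" and card: "CARD('x) = 3"
  shows "depth c (p u v)"
proof -
  let ?D = "\<lambda>d. \<forall>x y. depth d (p (lie_gen x) (lie_gen y))"
  have 2: "?D 2"
    using degree_one_zero[OF c card]
    by (auto simp: depth_def numeral_2_eq_2 less_Suc_eq length_Suc_conv)
  have 3: "?D 3"
    using 2 degree_two_zero[OF c card]
    by (auto simp: depth_def numeral_3_eq_3 less_Suc_eq length_Suc_conv)
  have "?D d" if "3 \<le> d" "d \<le> c" for d
    using that
  proof (induction d rule: dec_induct)
    case base
    then show ?case using 3 by simp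
  next
    case (step d)
    then obtain e where "d = Suc e" by (cases d) auto
    then show ?case using step depth_raise[of e, OF _ _ card] by auto
  qed
  then have "?D c" using c by simp
  moreover obtain e where "c = Suc e" using c by (cases c) auto
  ultimately show ?thesis
    using depth_prod[of e "Suc 0" v u] depth_1 by simp
qed

end

text \<open>Every product has a representative of depth \<open>c\<close>, and one more bracket
  produces only words longer than \<open>c\<close>, which are zero in the quotient.\<close>

theorem theorem4p3:
  fixes dot :: "('k::field_char_0, 'x) free_lie set \<Rightarrow> ('k, 'x) free_lie set \<Rightarrow> ('k, 'x) free_lie set"
    and c :: nat
  assumes "CARD('x) = 3"
    and "c \<ge> 3"
    and "cpa_structure scalars (free_nilpotent c) dot"
  shows "central_product (free_nilpotent c) dot"
proof -
  interpret C: cpa_structure "scalars :: 'k ring" "free_nilpotent c" dot by (rule assms(3))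
  have fin: "finite (UNIV :: 'x set)"
    using assms(1) by (metis card.infinite zero_neq_numeral)
  let ?cl = "nil_class c :: ('k, 'x) free_lie \<Rightarrow> _"
  note cl = free_nilpotent_nil_class[OF fin, of c]
  note cl_eq = nil_class_eq_iff[OF fin, of c]
  have in_car: "?cl u \<in> carrier (free_nilpotent c)" for u
    by (simp add: cl)
  have minus: "?cl u \<ominus>\<^bsub>free_nilpotent c\<^esub> ?cl v = ?cl (u - v)" for u v
  proof -
    have "\<ominus>\<^bsub>free_nilpotent c\<^esub> ?cl v = ?cl (- v)"
      by (rule C.L.M.minus_equality) (simp_all add: in_car cl(2,3))
    then show ?thesis by (simp add: a_minus_def cl(3))
  qed
  \<comment> \<open>An arbitrary choice of representatives in the free Lie algebra, determined only
    up to words longer than \<open>c\<close>.\<close>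
  define p where "p u v = (SOME z. ?cl z = dot (?cl u) (?cl v))" for u v
  have p: "?cl (p u v) = dot (?cl u) (?cl v)" for u v
  proof -
    have "dot (?cl u) (?cl v) \<in> range ?cl"
      using C.dot_closed[OF in_car in_car] by (simp add: cl(1))
    then have "\<exists>z. ?cl z = dot (?cl u) (?cl v)" by (metis imageE)
    then show ?thesis unfolding p_def by (rule someI_ex)
  qed
  interpret P: free_lie_product c p
  proof
    show "finite (UNIV :: 'x set)" by (rule fin)
  next
    fix w :: "'x list" and u v z :: "('k, 'x) free_lie" and k :: 'k
    assume w: "length w \<le> c"
    have coefI: "coef x w = coef y w" if "?cl x = ?cl y" for x y
      using that w by (simp add: cl_eq)
    have "?cl (p u (v + z)) = ?cl (p u v + p u z)"
      by (simp add: p cl(3)[symmetric] C.dot_add_right in_car)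
    from coefI[OF this] show "coef (p u (v + z)) w = coef (p u v) w + coef (p u z) w"
      by simp
    have "?cl (p u (lie_smult k v)) = ?cl (lie_smult k (p u v))"
      by (simp add: p cl(4)[symmetric] C.dot_smult_right in_car)
    from coefI[OF this] show "coef (p u (lie_smult k v)) w = k * coef (p u v) w"
      by simp
    have "?cl (p u v) = ?cl (p v u)"
      by (simp add: p C.dot_commute in_car)
    then show "coef (p u v) w = coef (p v u) w"
      by (rule coefI)
    have "?cl (p (lie_bracket u v) z) = ?cl (p u (p v z) - p v (p u z))"
      by (simp add: p minus[symmetric] cl(5)[symmetric] C.bracket_dot in_car)
    from coefI[OF this] show "coef (p (lie_bracket u v) z) w = coef (p u (p v z)) w - coef (p v (p u z)) w"
      by simp
    have "?cl (p u (lie_bracket v z)) = ?cl (lie_bracket (p u v) z + lie_bracket v (p u z))"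
      by (simp add: p cl(3,5)[symmetric] C.dot_bracket in_car)
    from coefI[OF this] show "coef (p u (lie_bracket v z)) w =
        coef (lie_bracket (p u v) z) w + coef (lie_bracket v (p u z)) w"
      by simp
  qed
  have zero: "?cl x \<otimes>\<^bsub>free_nilpotent c\<^esub> dot (?cl u) (?cl v) = \<zero>\<^bsub>free_nilpotent c\<^esub>" for x u v
  proof -
    have "coef (lie_bracket x (p u v)) w = 0" if "length w \<le> c" for w
      by (rule coef_bracket_vanish_Suc[of c])
        (use P.prod_depth[OF assms(2,1)] that in \<open>auto simp: P.depth_def\<close>)
    then have "?cl (lie_bracket x (p u v)) = ?cl 0"
      by (simp add: cl_eq)
    then show ?thesis by (simp add: p[symmetric] cl(2,5))
  qed
  show ?thesis
    unfolding central_product_def lie_center_def cl(1)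
    using C.dot_closed[OF in_car in_car] zero by (auto simp: cl(1))
qed

end
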